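(* As $n\to\infty$, $$M(n)\ge\left(\frac{19}{108}-o(1)\right)\frac{n^3}{\log n}.$$
   Context: For $N\in\mathbb N=\{1,2,\dots\}$ write $[N]=\{1,\dots,N\}$. A finite family $(C_d)_{d\in D}$ of finite subsets of $\mathbb Z$ is packed into $[N]$ if there are integers $\sigma_d$ ($d\in D$) such that $\sigma_d+C_d\subseteq[N]$ for every $d\in D$ and the sets $\sigma_d+C_d$ are pairwise disjoint. For $n,d\in\mathbb N$ put $B_d=\{jd:1\le j\le n\}$ (depending on $n$). $M(n)$ is the least $N$ for which $(B_d)_{d\in[n]}$ can be packed into $[N]$. Logarithms are natural. *)

theory Defs
  imports Complex_Main "HOL-Library.Disjoint_Sets" "HOL-Library.Landau_Symbols"
begin

definition packed_into :: "'i set \<Rightarrow> ('i \<Rightarrow> int set) \<Rightarrow> nat \<Rightarrow> bool" where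
  "packed_into D C N \<longleftrightarrow>
     (\<exists>\<sigma> :: 'i \<Rightarrow> int.
        (\<forall>d\<in>D. (\<lambda>x. \<sigma> d + x) ` C d \<subseteq> {1..int N}) \<and>
        disjoint_family_on (\<lambda>d. (\<lambda>x. \<sigma> d + x) ` C d) D)"

definition prog :: "nat \<Rightarrow> nat \<Rightarrow> int set" where
  "prog n d = {int j * int d | j. 1 \<le> j \<and> j \<le> n}"

definition min_pack :: "nat \<Rightarrow> nat" where
  "min_pack n = (LEAST N. 1 \<le> N \<and> packed_into {1..n} (prog n) N)"

(* The least element exists, so min_pack is not an arbitrary value of LEAST. *)
lemma ex_packed_into_prog: "\<exists>N\<ge>1. packed_into {1..n} (prog n) N"
proof -
  define \<sigma> where "\<sigma> = (\<lambda>d. (int d - 1) * (int n * int n))"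
  have bd: "\<sigma> d < \<sigma> d + x \<and> \<sigma> d + x \<le> int d * (int n * int n)"
    if d: "d \<in> {1..n}" and x: "x \<in> prog n d" for d x
  proof -
    obtain j where j: "x = int j * int d" "1 \<le> j" "j \<le> n"
      using x by (auto simp: prog_def)
    have "0 < x" using j d by auto
    moreover have "x \<le> int n * int n"
      unfolding j(1) using j d by (intro mult_mono) auto
    ultimately show ?thesis by (simp add: \<sigma>_def algebra_simps)
  qed
  have sub: "(\<lambda>x. \<sigma> d + x) ` prog n d \<subseteq> {1..int (n * n * n + 1)}" if d: "d \<in> {1..n}" for d
  proof
    fix y assume "y \<in> (\<lambda>x. \<sigma> d + x) ` prog n d"
    then have y: "\<sigma> d < y" "y \<le> int d * (int n * int n)" using bd[OF d] by auto
    have "0 \<le> \<sigma> d" using d by (simp add: \<sigma>_def)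
    moreover have "int d * (int n * int n) \<le> int n * (int n * int n)"
      using d by (intro mult_right_mono) auto
    ultimately show "y \<in> {1..int (n * n * n + 1)}" using y by (simp add: algebra_simps)
  qed
  have lt: "(\<lambda>x. \<sigma> d + x) ` prog n d \<inter> (\<lambda>x. \<sigma> e + x) ` prog n e = {}"
    if "d \<in> {1..n}" "e \<in> {1..n}" "d < e" for d e
  proof -
    have "int d * (int n * int n) \<le> \<sigma> e"
      unfolding \<sigma>_def using that(3) by (intro mult_right_mono) auto
    then show ?thesis using bd[OF that(1)] bd[OF that(2)] by fastforce
  qed
  have "disjoint_family_on (\<lambda>d. (\<lambda>x. \<sigma> d + x) ` prog n d) {1..n}"
    unfolding disjoint_family_on_def
  proof (intro ballI impI)
    fix d e assume *: "d \<in> {1..n}" "e \<in> {1..n}" "d \<noteq> e"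
    then consider "d < e" | "e < d" by linarith
    then show "(\<lambda>x. \<sigma> d + x) ` prog n d \<inter> (\<lambda>x. \<sigma> e + x) ` prog n e = {}"
      by cases (use lt[of d e] lt[of e d] * in blast)+
  qed
  then have "packed_into {1..n} (prog n) (n * n * n + 1)"
    unfolding packed_into_def using sub by blast
  then show ?thesis by (intro exI[of _ "n * n * n + 1"]) auto
qed

end

theory Submission
  imports Defs
    "HOL-Complex_Analysis.Complex_Analysis"
    "HOL-Number_Theory.Prime_Powers"
    "HOL-Computational_Algebra.Squarefree"
    "HOL-Library.Discrete_Functions"
    "HOL-Real_Asymp.Real_Asymp"
begin

text \<open>
Suppose that the progressions are packed. By the Chinese remainder theorem, two disjoint progressions with
coprime differences \<open>d, e < n\<close> cannot share a window of length \<open>d * e\<close>. A hull has length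
\<open>(n - 1) * d\<close>, which is too long for it to lie inside another one. So in a family of pairwise coprime
differences the hulls are ordered along the line and neighbours overlap by at most
\<open>d * e \<le> (d\<^sup>2 + e\<^sup>2) / 2\<close>, whence \<open>N\<close> is at least the sum of
\<open>(n - 1) * d - d\<^sup>2\<close> over the family (\<open>sum_le_span_if_overlaps_bounded\<close> and
\<open>overlap_le_of_disjoint_progs\<close>).

The primes below \<open>n\<close> give the constant \<open>1 / 2 - 1 / 3 = 1 / 6\<close>. For \<open>p < n / 3\<close> the
difference \<open>2 * p\<close> contributes more than \<open>p\<close>. Two differences \<open>2 * p\<close> and \<open>2 * q\<close>
behave like coprime ones if their progressions have shifts of the same parity. One of the two parities carries
at least half of the possible improvement, and this half is worth another \<open>1 / 108\<close>
(\<open>sum_primes_le_of_packed\<close>, in scaled form \<open>packed_into_ge_sum_gain\<close>).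

It remains to evaluate the sum of \<open>gain (p / n)\<close> over the primes \<open>p < n\<close>, which requires the prime
number theorem \<open>psi_asymptotic\<close>. Its proof follows Newman. The zeta function, freed from its pole, is
holomorphic and nonzero on the closed half plane (\<open>zeta_regularized_nonzero\<close>, by the Euler product and
the 3-4-1 inequality). Newman's contour integral \<open>newman\<close> turns this into the convergence of
\<open>\<Sum>n. moebius_mu n / n\<close> to 0, so that the mean value of \<open>moebius_mu\<close> is 0. Axer's argument
passes from there to the primes: up to a constant, \<open>psi N - N\<close> is the summatory function of the
convolution of \<open>moebius_mu\<close> with a function whose partial sums are \<open>O (sqrt N)\<close> by Dirichlet's divisor
estimate (\<open>psi_minus_eq\<close>, \<open>comparison_sum_bound\<close>).
\<close>

section \<open>Hulls of disjoint progressions\<close>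

text \<open>Add the intervals in the order of their right ends. If \<open>e\<close> is the last one so far, the next
interval \<open>d\<close> extends the span by at least \<open>m * d - d * e\<close>: this is the hypothesis \<open>overlap\<close>, which
in the application also excludes nested intervals. The estimate \<open>d * e \<le> (d\<^sup>2 + e\<^sup>2) / 2\<close> charges half of the
overlap to either neighbour. The last interval \<open>t\<close> has then been charged only once, hence the extra term
\<open>t\<^sup>2\<close> in the induction.\<close>

lemma sum_le_span_if_overlaps_bounded:
  fixes l r :: "nat \<Rightarrow> int" and m a b :: int
  assumes "finite D" and "a \<le> b"
    and len: "\<And>d. d \<in> D \<Longrightarrow> r d - l d = m * int d"
    and overlap: "\<And>d e. \<lbrakk>d \<in> D; e \<in> D; d \<noteq> e; r e \<le> r d\<rbrakk> \<Longrightarrow> r e - l d \<le> int d * int e"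
    and lower: "\<And>d. d \<in> D \<Longrightarrow> a \<le> l d" and upper: "\<And>d. d \<in> D \<Longrightarrow> r d \<le> b"
  shows "(\<Sum>d\<in>D. m * int d - (int d)\<^sup>2) \<le> b - a"
proof (cases "D = {}")
  case False
  define S where "S = (\<lambda>X. \<Sum>d\<in>X. m * int d - (int d)\<^sup>2)"
  have "X \<subseteq> D \<Longrightarrow> X \<noteq> {} \<Longrightarrow>
      \<exists>t\<in>X. (\<forall>e\<in>X. r e \<le> r t) \<and> 2 * S X + (int t)\<^sup>2 \<le> 2 * (r t - a)" if "finite X" for X
    using that
  proof (induction X rule: finite_ranking_induct[where f = r])
    case (insert d X)
    show ?case
    proof (cases "X = {} \<or> d \<in> X")
      case True
      then show ?thesis
      proof (cases "d \<in> X")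
        case True
        then show ?thesis using insert by (metis insert_absorb)
      next
        case False
        with True have "X = {}" by auto
        then have "S (insert d X) = m * int d - (int d)\<^sup>2" by (simp add: S_def)
        moreover have "0 \<le> (int d)\<^sup>2" by simp
        moreover have "r d - l d = m * int d" "a \<le> l d"
          using len[of d] lower[of d] insert.prems by auto
        ultimately have "2 * S (insert d X) + (int d)\<^sup>2 \<le> 2 * (r d - a)"
          by (smt (verit))
        then show ?thesis using \<open>X = {}\<close> by auto
      qed
    next
      case False
      then obtain t where t: "t \<in> X" "\<And>e. e \<in> X \<Longrightarrow> r e \<le> r t"
        "2 * S X + (int t)\<^sup>2 \<le> 2 * (r t - a)"
        using insert by auto
      have "d \<in> D" "t \<in> D" "d \<noteq> t" "r t \<le> r d" using insert t False by auto
      then have "r t - l d \<le> int d * int t" using overlap by blast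
      moreover have "2 * (int d * int t) \<le> (int d)\<^sup>2 + (int t)\<^sup>2"
        using zero_le_power2[of "int d - int t"] by (simp add: power2_diff)
      moreover have "S (insert d X) = m * int d - (int d)\<^sup>2 + S X"
        using False insert.hyps by (simp add: S_def)
      ultimately have "2 * S (insert d X) + (int d)\<^sup>2 \<le> 2 * (r d - a)"
        using t(3) len[OF \<open>d \<in> D\<close>] by (smt (verit))
      then show ?thesis using insert.hyps(2) by auto
    qed
  qed auto
  from this[OF \<open>finite D\<close>] False obtain t where
    "t \<in> D" "2 * S D + (int t)\<^sup>2 \<le> 2 * (r t - a)" by auto
  then have "2 * S D \<le> 2 * (b - a)" using upper[of t] zero_le_power2[of "int t"] by (smt (verit))
  then show ?thesis by (simp add: S_def)
qed (use \<open>a \<le> b\<close> in auto)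

text \<open>If the gcd of the differences divides the difference of the shifts, the residue classes of the two
progressions have a common element in every window of length \<open>d * e\<close>. Such a window inside both
hulls contradicts disjointness. Because \<open>d < n\<close>, the hull of the second progression itself has length at
least \<open>d * e\<close>; therefore the bound also covers the case that it starts after the first one, that is,
it rules out nested hulls.\<close>

lemma overlap_le_of_disjoint_progs:
  fixes d e n :: nat and s t :: int
  assumes "0 < d" "0 < e" "d < n"
    and disj: "(\<lambda>x. s + x) ` prog n d \<inter> (\<lambda>x. t + x) ` prog n e = {}"
    and cong: "gcd (int d) (int e) dvd t - s"
    and le: "t + int n * int e \<le> s + int n * int d"
  shows "t + int n * int e - (s + int d) \<le> int d * int e"
proof (rule ccontr)
  assume big: "\<not> ?thesis"
  \<comment> \<open>Beyond this point both hulls have begun; neither ends before \<open>lo + d * e\<close>.\<close>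
  define lo where "lo = max (s + int d) (t + int e)"
  have "int d * int e \<le> (int n - 1) * int e"
    using assms by (intro mult_right_mono) auto
  then have room: "lo + int d * int e \<le> t + int n * int e"
    using big by (auto simp: lo_def max_def algebra_simps)
  obtain u v where uv: "u * int d + v * int e = gcd (int d) (int e)"
    using bezout_int by blast
  obtain k where k: "t - s = gcd (int d) (int e) * k" using cong by blast
  \<comment> \<open>A common element of the two residue classes, from the Bezout coefficients.\<close>
  define x0 where "x0 = s + u * k * int d"
  have x0: "x0 = t - v * k * int e"
  proof -
    have "t - s = (u * int d + v * int e) * k" using k uv by simp
    then show ?thesis by (simp add: x0_def algebra_simps)
  qed
  define x where "x = lo + (x0 - lo) mod (int d * int e)"
  have pos: "0 < int d * int e" using assms by simp
  have x_ge: "lo \<le> x" and x_lt: "x < lo + int d * int e"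
    using pos by (auto simp: x_def)
  obtain q where q: "x = x0 - int d * int e * q"
  proof -
    have "x = x0 - int d * int e * ((x0 - lo) div (int d * int e))"
      by (simp add: x_def minus_div_mult_eq_mod[symmetric] algebra_simps)
    then show ?thesis using that by blast
  qed
  have mem: "x \<in> (\<lambda>x. c + x) ` prog n f"
    if "0 < f" "c + int f \<le> x" "x \<le> c + int n * int f" "x = c + j * int f" for c f j
  proof -
    have "1 * int f \<le> j * int f" "j * int f \<le> int n * int f" using that by auto
    then have j: "1 \<le> j" "j \<le> int n"
      using \<open>0 < f\<close> by (auto simp: mult_le_cancel_right)
    then have "j * int f \<in> prog n f"
      unfolding prog_def by (intro CollectI exI[of _ "nat j"]) auto
    then show ?thesis using that(4) by blast
  qed
  have "x \<in> (\<lambda>x. s + x) ` prog n d"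
  proof (rule mem[where j = "u * k - int e * q"])
    show "x = s + (u * k - int e * q) * int d"
      using q by (simp add: x0_def algebra_simps)
  qed (use assms x_ge x_lt room lo_def in auto)
  moreover have "x \<in> (\<lambda>x. t + x) ` prog n e"
  proof (rule mem[where j = "- v * k - int d * q"])
    show "x = t + (- v * k - int d * q) * int e"
      using q by (simp add: x0 algebra_simps)
  qed (use assms x_ge x_lt room lo_def in auto)
  ultimately show False using disj by blast
qed

lemma sum_le_of_packed_subfamily:
  fixes \<sigma> :: "nat \<Rightarrow> int"
  assumes D: "D \<subseteq> {1..<n}"
    and sub: "\<And>d. d \<in> D \<Longrightarrow> (\<lambda>x. \<sigma> d + x) ` prog n d \<subseteq> {1..int N}"
    and disj: "disjoint_family_on (\<lambda>d. (\<lambda>x. \<sigma> d + x) ` prog n d) D"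
    and cong: "\<And>d e. d \<in> D \<Longrightarrow> e \<in> D \<Longrightarrow> d \<noteq> e \<Longrightarrow> gcd (int d) (int e) dvd \<sigma> e - \<sigma> d"
  shows "(\<Sum>d\<in>D. (int n - 1) * int d - (int d)\<^sup>2) \<le> int N"
proof -
  have ends: "\<sigma> d + int d \<in> {1..int N}" "\<sigma> d + int n * int d \<in> {1..int N}" if "d \<in> D" for d
  proof -
    have "1 \<le> n" using D that by auto
    then have "int 1 * int d \<in> prog n d" "int n * int d \<in> prog n d"
      unfolding prog_def by blast+
    then show "\<sigma> d + int d \<in> {1..int N}" "\<sigma> d + int n * int d \<in> {1..int N}"
      using sub[OF that] by (auto simp: image_subset_iff)
  qed
  have "(\<Sum>d\<in>D. (int n - 1) * int d - (int d)\<^sup>2) \<le> int N - 0"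
  proof (rule sum_le_span_if_overlaps_bounded
      [where l = "\<lambda>d. \<sigma> d + int d" and r = "\<lambda>d. \<sigma> d + int n * int d"])
    fix d e assume "d \<in> D" "e \<in> D" "d \<noteq> e" "\<sigma> e + int n * int e \<le> \<sigma> d + int n * int d"
    then show "\<sigma> e + int n * int e - (\<sigma> d + int d) \<le> int d * int e"
      using D cong disj
      by (intro overlap_le_of_disjoint_progs) (auto simp: disjoint_family_on_def)
  qed (use D ends finite_subset in \<open>fastforce simp: algebra_simps\<close>)+
  then show ?thesis by simp
qed

text \<open>Apply the previous bound to a family with one difference for each odd prime \<open>p < n\<close>: either \<open>p\<close> or
\<open>2 * p\<close>. Two numbers of this kind have gcd 1 unless both are doubled, and then the gcd 2 divides the
difference of the shifts when these have the same parity. So \<open>p\<close> is doubled only if the shift of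
\<open>2 * p\<close> has parity \<open>c\<close>. Each \<open>p\<close> is doubled for exactly one of the two values of
\<open>c\<close>, and adding the two inequalities gives the claim.\<close>

lemma sum_primes_le_of_packed:
  assumes "packed_into {1..n} (prog n) N" and n: "3 \<le> n"
  defines "f \<equiv> \<lambda>d. (int n - 1) * int d - (int d)\<^sup>2"
  shows "(\<Sum>p | prime p \<and> 3 \<le> p \<and> p < n.
            2 * f p + (if 3 * p \<le> n then f (2 * p) - f p else 0)) \<le> 2 * int N"
proof -
  obtain \<sigma> where
    sub: "\<And>d. d \<in> {1..n} \<Longrightarrow> (\<lambda>x. \<sigma> d + x) ` prog n d \<subseteq> {1..int N}" and
    disj: "disjoint_family_on (\<lambda>d. (\<lambda>x. \<sigma> d + x) ` prog n d) {1..n}"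
    using assms(1) unfolding packed_into_def by blast
  define P where "P = {p. prime p \<and> 3 \<le> p \<and> p < n}"
  have "finite P" by (rule finite_subset[of _ "{..<n}"]) (auto simp: P_def)
  have oddP: "odd p" if "p \<in> P" for p using that prime_odd_nat[of p] by (auto simp: P_def)
  \<comment> \<open>The bound \<open>3 * p \<le> n\<close> marks the primes for which doubling pays.\<close>
  define \<delta> where "\<delta> = (\<lambda>c p. if 3 * p \<le> n \<and> \<sigma> (2 * p) mod 2 = c then 2 * p else p)"
  have \<delta>_less: "\<delta> c p \<in> {1..<n}" if "p \<in> P" for c p
    using that n by (auto simp: \<delta>_def P_def)
  have coprime_PP: "coprime p q" if "p \<in> P" "q \<in> P" "p \<noteq> q" for p q
    using that by (auto simp: P_def primes_coprime)
  have bound: "(\<Sum>p\<in>P. f (\<delta> c p)) \<le> int N" for c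
  proof -
    have inj: "inj_on (\<delta> c) P"
    proof (rule inj_onI, rule ccontr)
      fix p q assume pq: "p \<in> P" "q \<in> P" "\<delta> c p = \<delta> c q" "p \<noteq> q"
      then show False using oddP[of p] oddP[of q] by (auto simp: \<delta>_def split: if_splits)
    qed
    have "(\<Sum>d\<in>\<delta> c ` P. f d) \<le> int N"
      unfolding f_def
    proof (rule sum_le_of_packed_subfamily)
      show sub1: "\<delta> c ` P \<subseteq> {1..<n}" using \<delta>_less by blast
      show "(\<lambda>x. \<sigma> d + x) ` prog n d \<subseteq> {1..int N}" if "d \<in> \<delta> c ` P" for d
        by (rule sub) (use sub1 that in fastforce)
      show "disjoint_family_on (\<lambda>d. (\<lambda>x. \<sigma> d + x) ` prog n d) (\<delta> c ` P)"
        by (rule disjoint_family_on_mono[OF _ disj]) (use sub1 in fastforce)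
      fix d e assume "d \<in> \<delta> c ` P" "e \<in> \<delta> c ` P" "d \<noteq> e"
      then obtain p q where pq: "p \<in> P" "q \<in> P" "p \<noteq> q" "d = \<delta> c p" "e = \<delta> c q" by auto
      have cop: "coprime p q" using coprime_PP pq by blast
      show "gcd (int d) (int e) dvd \<sigma> e - \<sigma> d"
      proof (cases "d = 2 * p \<and> e = 2 * q")
        case True
        then have "\<sigma> d mod 2 = c" "\<sigma> e mod 2 = c"
          using pq oddP by (auto simp: \<delta>_def split: if_splits)
        then have "2 dvd \<sigma> e - \<sigma> d" by (metis mod_eq_dvd_iff)
        moreover have "gcd (2 * p) (2 * q) = 2" using cop by (simp add: gcd_mult_distrib_nat[symmetric])
        then have "gcd (int d) (int e) = 2" using True by (metis gcd_int_int_eq of_nat_numeral)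
        ultimately show ?thesis by simp
      next
        case False
        have "coprime d e"
          using False pq cop oddP[OF pq(1)] oddP[OF pq(2)] by (auto simp: \<delta>_def split: if_splits)
        then show ?thesis by simp
      qed
    qed
    then show ?thesis using inj by (simp add: sum.reindex)
  qed
  have "2 * f p + (if 3 * p \<le> n then f (2 * p) - f p else 0) = f (\<delta> 0 p) + f (\<delta> 1 p)" for p
  proof -
    have "\<sigma> (2 * p) mod 2 = 0 \<or> \<sigma> (2 * p) mod 2 = 1" by presburger
    then show ?thesis by (auto simp: \<delta>_def)
  qed
  then have "(\<Sum>p\<in>P. 2 * f p + (if 3 * p \<le> n then f (2 * p) - f p else 0))
      = (\<Sum>p\<in>P. f (\<delta> 0 p)) + (\<Sum>p\<in>P. f (\<delta> 1 p))"
    by (simp add: sum.distrib)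
  also have "\<dots> \<le> 2 * int N" using bound[of 0] bound[of 1] by simp
  finally show ?thesis by (simp add: P_def)
qed

section \<open>Euler product and the 3-4-1 inequality\<close>

definition zeta :: "complex \<Rightarrow> complex" where
  "zeta s = (\<Sum>\<^sub>\<infinity>n\<in>{1..}. of_nat n powr (-s))"

lemma norm_nat_powr: "cmod (of_nat n powr s) = real n powr Re s"
  by (simp add: norm_powr_real_powr)

lemma nat_powr_mult: "(of_nat (m * n) :: complex) powr s = of_nat m powr s * of_nat n powr s"
  by (simp add: powr_times_real)

lemma real_powr_summable_on:
  fixes A :: "nat set"
  assumes "1 < a" shows "(\<lambda>n. real n powr (-a)) summable_on A"
proof -
  have "summable (\<lambda>n. norm (real n powr (-a)))"
    using assms by (simp add: summable_real_powr_iff)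
  then have "(\<lambda>n. real n powr (-a)) summable_on UNIV" by (rule norm_summable_imp_summable_on)
  then show ?thesis by (rule summable_on_subset_banach) auto
qed

lemma bounded_dirichlet_abs_summable_on:
  assumes "1 < Re s" and "\<And>n. cmod (a n) \<le> 1"
  shows "(\<lambda>n. cmod (a n * of_nat n powr (-s))) summable_on A"
proof (rule summable_on_comparison_test[OF real_powr_summable_on[OF assms(1)]])
  fix n show "cmod (a n * of_nat n powr (-s)) \<le> real n powr (- Re s)"
    using mult_right_mono[OF assms(2)[of n], of "real n powr (- Re s)"]
    by (simp add: norm_mult norm_nat_powr)
qed auto

lemma dirichlet_abs_summable_on:
  assumes "1 < Re s" shows "(\<lambda>n. cmod (of_nat n powr (-s))) summable_on A"
  using bounded_dirichlet_abs_summable_on[OF assms, of "\<lambda>_. 1"] by simp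

lemma dirichlet_summable_on:
  assumes "1 < Re s" shows "(\<lambda>n. of_nat n powr (-s) :: complex) summable_on A"
  using dirichlet_abs_summable_on[OF assms] by (rule Infinite_Sum.abs_summable_summable)

text \<open>Multiplying by \<open>1 - of_nat p powr (-s)\<close> removes from the series the multiples of \<open>p\<close>.\<close>

lemma zeta_mult_prod_primes:
  assumes "1 < Re s" and "finite P" and "\<And>p. p \<in> P \<Longrightarrow> prime (p :: nat)"
  shows "zeta s * (\<Prod>p\<in>P. 1 - of_nat p powr (-s))
       = (\<Sum>\<^sub>\<infinity>n\<in>{n. 1 \<le> n \<and> (\<forall>p\<in>P. \<not> p dvd n)}. of_nat n powr (-s))"
  using assms(2,3)
proof (induction P rule: finite_induct)
  case empty
  have "{n. Suc 0 \<le> n} = {Suc 0..}" by auto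
  then show ?case by (simp add: zeta_def)
next
  case (insert p P)
  let ?f = "\<lambda>n. of_nat n powr (-s) :: complex"
  define A where "A = {n. 1 \<le> n \<and> (\<forall>p\<in>P. \<not> p dvd n)}"
  have p: "prime p" "0 < p" using insert.prems prime_gt_0_nat by auto
  note summ = dirichlet_summable_on[OF assms(1)]
  have image: "{n \<in> A. p dvd n} = (\<lambda>n. p * n) ` A"
  proof -
    have "q dvd p * n \<longleftrightarrow> q dvd n" if "q \<in> P" for q n
      using that insert p by (metis insertCI prime_dvd_mult_iff primes_dvd_imp_eq)
    then show ?thesis using p by (auto simp: A_def)
  qed
  have "A = {n \<in> A. \<not> p dvd n} \<union> {n \<in> A. p dvd n}" by auto
  then have "infsum ?f A = infsum ?f ({n \<in> A. \<not> p dvd n} \<union> {n \<in> A. p dvd n})" by simp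
  also have "\<dots> = infsum ?f {n \<in> A. \<not> p dvd n} + infsum ?f {n \<in> A. p dvd n}"
    by (rule infsum_Un_disjoint) (auto intro: summ)
  also have "infsum ?f {n \<in> A. p dvd n} = (\<Sum>\<^sub>\<infinity>n\<in>A. ?f (p * n))"
    unfolding image using p by (subst infsum_reindex) (auto simp: inj_on_def comp_def)
  also have "\<dots> = ?f p * infsum ?f A"
    by (simp only: nat_powr_mult infsum_cmult_right')
  finally have "infsum ?f {n \<in> A. \<not> p dvd n} = infsum ?f A * (1 - ?f p)"
    by (simp add: algebra_simps)
  moreover have "zeta s * (\<Prod>p\<in>P. 1 - ?f p) = infsum ?f A"
    using insert by (simp add: A_def)
  moreover have "{n \<in> A. \<not> p dvd n} = {n. 1 \<le> n \<and> (\<forall>p\<in>insert p P. \<not> p dvd n)}"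
    by (auto simp: A_def)
  ultimately have "(zeta s * (\<Prod>p\<in>P. 1 - ?f p)) * (1 - ?f p)
      = infsum ?f {n. 1 \<le> n \<and> (\<forall>p\<in>insert p P. \<not> p dvd n)}" by simp
  then show ?case using insert.hyps by (simp add: mult_ac)
qed

lemma euler_product:
  assumes s: "1 < Re s"
  shows "(\<lambda>N. zeta s * (\<Prod>p | prime p \<and> p \<le> N. 1 - of_nat p powr (-s))) \<longlonglongrightarrow> 1"
proof -
  let ?f = "\<lambda>n. of_nat n powr (-s) :: complex" and ?g = "\<lambda>n. real n powr (- Re s)"
  have g: "?g summable_on B" for B :: "nat set" using real_powr_summable_on[OF s] .
  have bound: "norm (zeta s * (\<Prod>p | prime p \<and> p \<le> N. 1 - ?f p) - 1) \<le> infsum ?g UNIV - sum ?g {..N}"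
    if "1 \<le> N" for N
  proof -
    define A where "A = {n. 1 \<le> n \<and> (\<forall>p\<in>{p. prime p \<and> p \<le> N}. \<not> p dvd n)}"
    have "1 \<in> A" by (auto simp: A_def)
    have sub: "A - {1} \<subseteq> {N<..}"
    proof
      fix n assume n: "n \<in> A - {1}"
      then obtain p where "prime p" "p dvd n" using prime_factor_nat[of n] by auto
      moreover have "p \<le> n" using n \<open>p dvd n\<close> by (intro dvd_imp_le) (auto simp: A_def)
      ultimately show "n \<in> {N<..}" using n by (auto simp: A_def not_le[symmetric])
    qed
    have "zeta s * (\<Prod>p | prime p \<and> p \<le> N. 1 - ?f p) = infsum ?f A"
      unfolding A_def by (rule zeta_mult_prod_primes[OF s]) auto
    also have "\<dots> = infsum ?f (insert 1 (A - {1}))" using \<open>1 \<in> A\<close> by (simp add: insert_absorb)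
    also have "\<dots> = 1 + infsum ?f (A - {1})"
      using infsum_insert[OF dirichlet_summable_on[OF s], of 1 "A - {1}"] by simp
    finally have "norm (zeta s * (\<Prod>p | prime p \<and> p \<le> N. 1 - ?f p) - 1) = norm (infsum ?f (A - {1}))"
      by simp
    also have "\<dots> \<le> (\<Sum>\<^sub>\<infinity>n\<in>A - {1}. norm (?f n))"
      by (rule norm_infsum_bound[OF dirichlet_abs_summable_on[OF s]])
    also have "\<dots> = infsum ?g (A - {1})" by (simp add: norm_nat_powr)
    also have "\<dots> \<le> infsum ?g {N<..}" by (rule infsum_mono2[OF g g sub]) auto
    also have "{N<..} = UNIV - {..N}" by auto
    also have "infsum ?g \<dots> = infsum ?g UNIV - sum ?g {..N}"
      by (subst infsum_Diff) (auto intro: g)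
    finally show ?thesis .
  qed
  have "?g sums infsum ?g UNIV" using has_sum_imp_sums[OF has_sum_infsum[OF g]] .
  then have "(\<lambda>N. infsum ?g UNIV - sum ?g {..N}) \<longlonglongrightarrow> infsum ?g UNIV - infsum ?g UNIV"
    by (intro tendsto_intros) (simp add: sums_def_le)
  then have lim: "(\<lambda>N. infsum ?g UNIV - sum ?g {..N}) \<longlonglongrightarrow> 0" by simp
  have "\<forall>\<^sub>F N in sequentially. norm (zeta s * (\<Prod>p | prime p \<and> p \<le> N. 1 - ?f p) - 1)
      \<le> infsum ?g UNIV - sum ?g {..N}"
    using bound by (rule eventually_sequentiallyI)
  then have "(\<lambda>N. zeta s * (\<Prod>p | prime p \<and> p \<le> N. 1 - ?f p) - 1) \<longlonglongrightarrow> 0"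
    using lim by (rule Lim_null_comparison)
  then show ?thesis by (simp add: LIM_zero_iff)
qed

lemma norm_one_minus_of_real: "r \<le> 1 \<Longrightarrow> cmod (1 - of_real r) = 1 - r"
  by (metis abs_of_nonneg diff_ge_0_iff_ge norm_of_real of_real_1 of_real_diff)

text \<open>The logarithm of the left side is \<open>- (\<Sum>n. r ^ n / n * (3 + 4 * c n + c' n))\<close> with
\<open>c n = Re (w ^ n)\<close> and \<open>c' n = 2 * (c n)\<^sup>2 - 1\<close>, and
\<open>3 + 4 * c + (2 * c\<^sup>2 - 1) = 2 * (1 + c)\<^sup>2\<close> is nonnegative.\<close>

lemma norm_euler_factor_341:
  assumes "0 \<le> r" "r < 1" and w: "cmod w = 1"
  shows "(1 - r) ^ 3 * cmod (1 - of_real r * w) ^ 4 * cmod (1 - of_real r * w\<^sup>2) \<le> 1"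
proof -
  have Re_ln: "(\<lambda>n. - Re (z ^ n) / real n) sums ln (cmod (1 - z))" if "cmod z < 1" for z
  proof -
    have "(\<lambda>n. - (z ^ n) / of_nat n) sums ln (1 - z)" using Ln_series'[of "- z"] that by simp
    moreover have "1 - z \<noteq> 0" using that by auto
    ultimately show ?thesis by (auto dest: sums_Re)
  qed
  have lt: "cmod (of_real r) < 1" "cmod (of_real r * w) < 1" "cmod (of_real r * w\<^sup>2) < 1"
    using assms by (simp_all add: norm_mult norm_power)
  have "(\<lambda>n. 3 * (- Re (of_real r ^ n) / real n) + 4 * (- Re ((of_real r * w) ^ n) / real n)
           + - Re ((of_real r * w\<^sup>2) ^ n) / real n)
      sums (3 * ln (cmod (1 - of_real r)) + 4 * ln (cmod (1 - of_real r * w))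
           + ln (cmod (1 - of_real r * w\<^sup>2)))"
    by (intro sums_add sums_mult Re_ln lt)
  moreover have "3 * (- Re (of_real r ^ n) / real n) + 4 * (- Re ((of_real r * w) ^ n) / real n)
      + - Re ((of_real r * w\<^sup>2) ^ n) / real n \<le> 0" for n
  proof -
    define v where "v = w ^ n"
    have "(Re v)\<^sup>2 + (Im v)\<^sup>2 = 1" using w by (simp add: v_def norm_power flip: cmod_power2)
    then have "3 + 4 * Re v + Re (v\<^sup>2) = 2 * (1 + Re v)\<^sup>2"
      by (simp add: power2_eq_square algebra_simps)
    then have "0 \<le> r ^ n * (3 + 4 * Re v + Re (v\<^sup>2)) / real n" using assms by simp
    moreover have "(w\<^sup>2) ^ n = v\<^sup>2" by (simp add: v_def flip: power_mult) (simp add: mult.commute)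
    ultimately show ?thesis
      by (simp add: power_mult_distrib v_def[symmetric] add_divide_distrib algebra_simps
          flip: of_real_power)
  qed
  ultimately have "3 * ln (cmod (1 - of_real r)) + 4 * ln (cmod (1 - of_real r * w))
      + ln (cmod (1 - of_real r * w\<^sup>2)) \<le> 0"
    by (metis (no_types, lifting) sums_le sums_zero)
  moreover have pos: "0 < cmod (1 - of_real r)" "0 < cmod (1 - of_real r * w)"
    "0 < cmod (1 - of_real r * w\<^sup>2)" using lt by auto
  ultimately have "ln (cmod (1 - of_real r) ^ 3 * cmod (1 - of_real r * w) ^ 4
      * cmod (1 - of_real r * w\<^sup>2)) \<le> ln 1"
    by (simp add: ln_mult ln_realpow)
  then have "cmod (1 - of_real r) ^ 3 * cmod (1 - of_real r * w) ^ 4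
      * cmod (1 - of_real r * w\<^sup>2) \<le> 1"
    by (subst (asm) ln_le_cancel_iff) (intro mult_pos_pos zero_less_power pos zero_less_one)+
  then show ?thesis using assms by (simp add: norm_one_minus_of_real)
qed

lemma zeta_product_341:
  assumes a: "1 < a"
  shows "1 \<le> cmod (zeta (of_real a)) ^ 3 * cmod (zeta (Complex a t)) ^ 4 * cmod (zeta (Complex a (2 * t)))"
proof -
  define E where "E = (\<lambda>s N. \<Prod>p | prime p \<and> p \<le> N. 1 - of_nat p powr (-s) :: complex)"
  define s0 s1 s2 where "s0 = complex_of_real a" "s1 = Complex a t" "s2 = Complex a (2 * t)"
  have E: "cmod (E s0 N) ^ 3 * cmod (E s1 N) ^ 4 * cmod (E s2 N) \<le> 1" for N
  proof -
    have "(\<Prod>p | prime p \<and> p \<le> N. cmod (1 - of_nat p powr (-s0)) ^ 3 *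
       cmod (1 - of_nat p powr (-s1)) ^ 4 * cmod (1 - of_nat p powr (-s2))) \<le> 1"
    proof (rule prod_le_1, safe)
      fix p :: nat assume "prime p"
      then have p: "1 < real p" using prime_gt_1_nat by auto
      define r w where "r = real p powr (-a)" "w = (of_nat p :: complex) powr Complex 0 (-t)"
      have r: "0 \<le> r" "r < 1" using a p by (auto simp: r_w_def powr_less_one)
      have w: "cmod w = 1" using p by (simp add: r_w_def norm_nat_powr)
      have powr_a: "of_nat p powr (of_real (-a)) = complex_of_real r"
        using powr_of_real[of "real p" "-a"] by (simp add: r_w_def)
      then have "of_nat p powr (-s0) = complex_of_real r"
        by (simp add: s0_s1_s2_def)
      moreover have "of_nat p powr (-s1) = of_real r * w"
      proof -
        have "- s1 = of_real (-a) + Complex 0 (-t)" by (simp add: s0_s1_s2_def complex_eq_iff)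
        then show ?thesis by (simp only: powr_add powr_a r_w_def(2))
      qed
      moreover have "of_nat p powr (-s2) = of_real r * w\<^sup>2"
      proof -
        have "- s2 = of_real (-a) + (Complex 0 (-t) + Complex 0 (-t))"
          by (simp add: s0_s1_s2_def complex_eq_iff)
        then show ?thesis by (simp only: powr_add powr_a r_w_def(2) power2_eq_square)
      qed
      ultimately show "cmod (1 - of_nat p powr (-s0)) ^ 3 *
         cmod (1 - of_nat p powr (-s1)) ^ 4 * cmod (1 - of_nat p powr (-s2)) \<le> 1"
        using norm_euler_factor_341[OF r w] by (simp add: norm_one_minus_of_real[OF less_imp_le[OF r(2)]])
    qed auto
    then show ?thesis by (simp add: E_def prod.distrib prod_norm[symmetric] prod_power_distrib)
  qed
  have lim: "(\<lambda>N. cmod (zeta s * E s N)) \<longlonglongrightarrow> 1" if "1 < Re s" for s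
    using tendsto_norm[OF euler_product[OF that]] by (simp add: E_def)
  have "(\<lambda>N. cmod (zeta s0 * E s0 N) ^ 3 * cmod (zeta s1 * E s1 N) ^ 4 * cmod (zeta s2 * E s2 N))
      \<longlonglongrightarrow> 1 ^ 3 * 1 ^ 4 * 1"
    using a by (intro tendsto_intros lim) (auto simp: s0_s1_s2_def)
  moreover have "cmod (zeta s0 * E s0 N) ^ 3 * cmod (zeta s1 * E s1 N) ^ 4 * cmod (zeta s2 * E s2 N)
      \<le> cmod (zeta s0) ^ 3 * cmod (zeta s1) ^ 4 * cmod (zeta s2)" for N
    using mult_left_mono[OF E[of N], of "cmod (zeta s0) ^ 3 * cmod (zeta s1) ^ 4 * cmod (zeta s2)"]
    by (simp add: norm_mult power_mult_distrib ac_simps)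
  ultimately show ?thesis
    unfolding s0_s1_s2_def[symmetric] by (intro LIMSEQ_le_const2[of _ 1]) auto
qed

section \<open>The zeta function on the closed half plane\<close>

text \<open>For \<open>Re s > 1\<close> the sum of these terms is \<open>(s - 1) * zeta s - 1\<close>, since the differences of
the powers \<open>n powr (1 - s)\<close> telescope. Each term is a second-order Taylor remainder of
\<open>t powr (1 - s)\<close>, so the series converges already for \<open>Re s > 0\<close>.\<close>

definition zeta_regularized_term :: "nat \<Rightarrow> complex \<Rightarrow> complex" where
  "zeta_regularized_term n s = (s - 1) * of_nat (Suc n) powr (-s)
     - of_nat (Suc n) powr (1 - s) + of_nat (Suc (Suc n)) powr (1 - s)"

text \<open>The continuation of \<open>(s - 1) * zeta s\<close> to \<open>Re s > 0\<close>.\<close>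

definition zeta_regularized :: "complex \<Rightarrow> complex" where
  "zeta_regularized s = 1 + (\<Sum>n. zeta_regularized_term n s)"

lemma norm_zeta_regularized_term_le:
  assumes "-1 \<le> Re s"
  shows "cmod (zeta_regularized_term n s) \<le> cmod s * cmod (s - 1) * real (Suc n) powr (-1 - Re s)"
proof -
  define f :: "nat \<Rightarrow> complex \<Rightarrow> complex" where
    "f = (\<lambda>i. if i = 0 then (\<lambda>z. z powr (1 - s)) else if i = 1 then (\<lambda>z. (1 - s) * z powr (-s))
          else (\<lambda>z. (1 - s) * (-s) * z powr (-s - 1)))"
  define a b :: real where "a = real (Suc n)" "b = real (Suc (Suc n))"
  have ab: "0 < a" "b = a + 1" by (auto simp: a_b_def)
  define S :: "complex set" where "S = closed_segment (of_real a) (of_real b)"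
  have S: "x = of_real (Re x)" "a \<le> Re x" if "x \<in> S" for x
    using that ab unfolding S_def closed_segment_of_real by (auto simp: closed_segment_eq_real_ivl)
  have "cmod (f 0 (of_real b) - (\<Sum>i\<le>1. f i (of_real a) * (of_real b - of_real a) ^ i / fact i))
      \<le> (cmod s * cmod (s - 1) * a powr (-1 - Re s)) * cmod (of_real b - of_real a) ^ Suc 1 / fact 1"
  proof (rule complex_Taylor)
    fix i :: nat and x assume x: "x \<in> S" and "i \<le> 1"
    have "x \<notin> \<real>\<^sub>\<le>\<^sub>0" using S[OF x] ab by (auto simp: complex_nonpos_Reals_iff)
    from has_field_derivative_powr[OF this]
    have d: "((\<lambda>z. z powr c) has_field_derivative c * x powr (c - 1)) (at x within S)" for c
      by (rule has_field_derivative_at_within)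
    have "i = 0 \<or> i = 1" using \<open>i \<le> 1\<close> by auto
    then show "(f i has_field_derivative f (Suc i) x) (at x within S)"
      using d[of "1 - s"] DERIV_cmult[OF d[of "-s"], of "1 - s"]
      by (auto simp: f_def algebra_simps)
  next
    fix x assume x: "x \<in> S"
    have "cmod (x powr (-s - 1)) = Re x powr (- Re s - 1)"
      using S[OF x] ab norm_powr_real_powr[of x "-s - 1"] by (metis Reals_of_real complex.sel(1)
          less_le_trans less_imp_le minus_complex.sel(1) one_complex.sel(1) uminus_complex.sel(1))
    also have "\<dots> \<le> a powr (-1 - Re s)"
      using S[OF x] ab assms by (simp only: diff_conv_add_uminus add.commute) (intro powr_mono2', auto)
    finally show "cmod (f (Suc 1) x) \<le> cmod s * cmod (s - 1) * a powr (-1 - Re s)"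
      by (simp add: f_def norm_mult norm_minus_commute[of 1 s] mult.commute[of "cmod s"] mult_left_mono)
  qed (auto simp: S_def)
  moreover have "f 0 (of_real b) - (\<Sum>i\<le>1. f i (of_real a) * (of_real b - of_real a) ^ i / fact i)
      = zeta_regularized_term n s"
    by (simp add: f_def zeta_regularized_term_def ab a_b_def(1) algebra_simps)
  ultimately show ?thesis by (simp add: ab a_b_def(1))
qed

lemma zeta_regularized_term_sums:
  assumes "0 < Re s" shows "(\<lambda>n. zeta_regularized_term n s) sums (zeta_regularized s - 1)"
  and "zeta_regularized field_differentiable (at s)"
proof -
  let ?S = "{s. 0 < Re s}"
  obtain g where g: "\<forall>x\<in>?S. (\<lambda>n. zeta_regularized_term n x) sums g x \<and> g field_differentiable (at x)"
  proof (rule series_differentiable_comparison_complex)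
    show "open ?S" by (rule open_halfspace_Re_gt)
    show "zeta_regularized_term n field_differentiable at x" for n x
    proof -
      have "of_nat (Suc n) \<noteq> (0::complex)" for n using of_nat_neq_0 by blast
      then have "(\<lambda>s. (s - 1) * exp (- s * ln (of_nat (Suc n))) - exp ((1 - s) * ln (of_nat (Suc n)))
           + exp ((1 - s) * ln (of_nat (Suc (Suc n))))) = zeta_regularized_term n"
        by (intro ext) (simp only: zeta_regularized_term_def powr_def if_False)
      moreover have "(\<lambda>s. (s - 1) * exp (- s * ln (of_nat (Suc n))) - exp ((1 - s) * ln (of_nat (Suc n)))
           + exp ((1 - s) * ln (of_nat (Suc (Suc n))))) field_differentiable at x"
        unfolding field_differentiable_def by (rule exI) (rule derivative_eq_intros refl)+
      ultimately show ?thesis by simp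
    qed
    fix x assume x: "x \<in> ?S"
    define e where "e = Re x / 2"
    have e: "0 < e" using x by (simp add: e_def)
    define h :: "nat \<Rightarrow> real" where
      "h = (\<lambda>n. ((cmod x + e) * (cmod x + e + 1)) * real (Suc n) powr (-1 - e))"
    have "summable (\<lambda>n. real n powr (-1 - e))" using e by (simp add: summable_real_powr_iff)
    then have "summable h"
      unfolding h_def by (intro summable_mult) (subst summable_Suc_iff)
    have "cmod (zeta_regularized_term n y) \<le> h n" if "y \<in> ball x e" for n y
    proof -
      have d: "cmod (y - x) < e" using that by (simp add: dist_norm norm_minus_commute)
      have y1: "e \<le> Re y" using abs_Re_le_cmod[of "y - x"] d by (simp add: e_def)
      have y2: "cmod y \<le> cmod x + e" using norm_triangle_ineq[of x "y - x"] d by simp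
      have y3: "cmod (y - 1) \<le> cmod x + e + 1" using norm_triangle_ineq4[of y 1] y2 by simp
      have "cmod (zeta_regularized_term n y) \<le> cmod y * cmod (y - 1) * real (Suc n) powr (-1 - Re y)"
        using norm_zeta_regularized_term_le y1 e by auto
      also have "\<dots> \<le> ((cmod x + e) * (cmod x + e + 1)) * real (Suc n) powr (-1 - e)"
        using y1 y2 y3 e by (intro mult_mono powr_mono) auto
      finally show ?thesis by (simp add: h_def)
    qed
    moreover have "0 \<le> h n" for n using e by (simp add: h_def)
    ultimately have "\<forall>n. \<forall>y\<in>ball x e \<inter> ?S. cmod (zeta_regularized_term n y) \<le> cmod (complex_of_real (h n))"
      by (auto intro: order_trans)
    moreover have "range (\<lambda>n. complex_of_real (h n)) \<subseteq> \<real>\<^sub>\<ge>\<^sub>0"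
      using \<open>\<And>n. 0 \<le> h n\<close> by auto
    moreover have "summable (\<lambda>n. complex_of_real (h n))" using \<open>summable h\<close> by (rule summable_of_real)
    ultimately show "\<exists>d h. 0 < d \<and> summable h \<and> range h \<subseteq> \<real>\<^sub>\<ge>\<^sub>0 \<and>
        (\<forall>\<^sub>F n in sequentially. \<forall>y\<in>ball x d \<inter> ?S. cmod (zeta_regularized_term n y) \<le> cmod (h n))"
      using e by (intro exI[of _ e] exI[of _ "\<lambda>n. complex_of_real (h n)"] conjI eventuallyI) auto
  qed
  then have eq: "g x + 1 = zeta_regularized x" if "0 < Re x" for x
    using that g by (simp add: zeta_regularized_def sums_iff)
  have "zeta_regularized s - 1 = g s" by (simp flip: eq[OF assms])
  then show "(\<lambda>n. zeta_regularized_term n s) sums (zeta_regularized s - 1)" using g assms by simp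
  have "(\<lambda>x. g x + 1) field_differentiable (at s)"
    using g assms by (intro field_differentiable_add field_differentiable_const) auto
  then obtain D where "((\<lambda>x. g x + 1) has_field_derivative D) (at s)"
    by (auto simp: field_differentiable_def)
  then have "(zeta_regularized has_field_derivative D) (at s)"
    by (rule has_field_derivative_transform_within_open[OF _ open_halfspace_Re_gt[of 0]])
       (simp_all add: assms eq)
  then show "zeta_regularized field_differentiable (at s)" by (auto simp: field_differentiable_def)
qed

lemma zeta_regularized_holomorphic: "zeta_regularized holomorphic_on {s. 0 < Re s}"
  using zeta_regularized_term_sums(2) by (simp add: holomorphic_on_open open_halfspace_Re_gt field_differentiable_def)

lemma zeta_regularized_1: "zeta_regularized 1 = 1"
  by (simp add: zeta_regularized_def zeta_regularized_term_def del: of_nat_Suc)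

lemma zeta_regularized_eq_zeta:
  assumes s: "1 < Re s" shows "zeta_regularized s = (s - 1) * zeta s"
proof -
  have "((\<lambda>n. of_nat n powr (-s) :: complex) has_sum zeta s) {1..}"
    unfolding zeta_def by (rule has_sum_infsum[OF dirichlet_summable_on[OF s]])
  moreover have "bij_betw Suc UNIV {1..}"
    by (auto simp: bij_betw_def image_iff Suc_le_eq gr0_conv_Suc)
  ultimately have "((\<lambda>n. of_nat (Suc n) powr (-s) :: complex) has_sum zeta s) UNIV"
    by (subst (asm) has_sum_reindex_bij_betw[symmetric])
  then have "(\<lambda>n. of_nat (Suc n) powr (-s)) sums zeta s" by (rule has_sum_imp_sums)
  then have 1: "(\<lambda>n. (s - 1) * of_nat (Suc n) powr (-s)) sums ((s - 1) * zeta s)"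
    by (rule sums_mult)
  have "(\<lambda>n. real n powr (1 - Re s)) \<longlonglongrightarrow> 0"
    using tendsto_neg_powr[OF _ filterlim_real_sequentially, of "1 - Re s"] s by simp
  then have "(\<lambda>n. cmod (of_nat n powr (1 - s))) \<longlonglongrightarrow> 0" by (simp add: norm_nat_powr)
  then have "(\<lambda>n. of_nat n powr (1 - s) :: complex) \<longlonglongrightarrow> 0" by (rule tendsto_norm_zero_cancel)
  then have "(\<lambda>n. of_nat (Suc n) powr (1 - s) :: complex) \<longlonglongrightarrow> 0" by (rule LIMSEQ_Suc)
  from telescope_sums[OF this]
  have "(\<lambda>n. of_nat (Suc (Suc n)) powr (1 - s) - of_nat (Suc n) powr (1 - s)) sums (-1 :: complex)"
    by (simp del: of_nat_Suc add: of_nat_Suc[of 0])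
  from sums_add[OF 1 this]
  have "(\<lambda>n. zeta_regularized_term n s) sums ((s - 1) * zeta s - 1)"
    by (simp add: zeta_regularized_term_def algebra_simps del: of_nat_Suc)
  moreover have "(\<lambda>n. zeta_regularized_term n s) sums (zeta_regularized s - 1)"
    using zeta_regularized_term_sums(1) s by simp
  ultimately show ?thesis using sums_unique2 by fastforce
qed

lemma zeta_nonzero: assumes "1 < Re s" shows "zeta s \<noteq> 0"
proof
  assume "zeta s = 0"
  then have "(\<lambda>_. 0) \<longlonglongrightarrow> (1 :: complex)" using euler_product[OF assms] by simp
  then show False by (simp add: LIMSEQ_const_iff)
qed

text \<open>On the line \<open>Re s = 1\<close>, a zero at \<open>1 + \<i> * t\<close> would make
\<open>zeta (1 + x + \<i> * t)\<close> of order \<open>x\<close> for \<open>x \<rightarrow> 0\<close>. In the 3-4-1 inequality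
the fourth power of this factor beats the third power of the pole at 1, while
\<open>zeta (1 + x + 2 * \<i> * t)\<close> stays bounded.\<close>

lemma zeta_regularized_nonzero:
  assumes "1 \<le> Re s" shows "zeta_regularized s \<noteq> 0"
proof (cases "s = 1 \<or> 1 < Re s")
  case True
  then show ?thesis using zeta_regularized_1 zeta_regularized_eq_zeta zeta_nonzero by auto
next
  case False
  with assms have s: "Re s = 1" "s \<noteq> 1" by auto
  define t where "t = Im s"
  have s_eq: "s = Complex 1 t" and "t \<noteq> 0" using s by (auto simp: t_def complex_eq_iff)
  show ?thesis
  proof
    assume zero: "zeta_regularized s = 0"
    let ?Z = zeta_regularized
    \<comment> \<open>The 3-4-1 product in terms of the regularized function: three powers of \<open>1 / x\<close> from the pole, and \<open>x ^ 4\<close> from the zero.\<close>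
    let ?q = "\<lambda>x. x * (cmod (?Z (1 + of_real x)) ^ 3 * (cmod (?Z (s + of_real x) / of_real x)) ^ 4 /
        cmod (Complex x t) ^ 4 * cmod (?Z (Complex 1 (2 * t) + of_real x)) / cmod (Complex x (2 * t)))"
    have ge: "1 \<le> ?q x" if "0 < x" for x
    proof -
      have z: "zeta w = ?Z w / (w - 1)" if "1 < Re w" for w
        using zeta_regularized_eq_zeta[OF that] that by auto
      have shift: "Complex 1 c + of_real x = Complex (1 + x) c" "Complex (1 + x) c - 1 = Complex x c"
        for c by (simp_all add: complex_eq_iff)
      have "1 \<le> cmod (zeta (of_real (1 + x))) ^ 3 * cmod (zeta (Complex (1 + x) t)) ^ 4
          * cmod (zeta (Complex (1 + x) (2 * t)))"
        using zeta_product_341[of "1 + x" t] that by simp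
      also have "zeta (of_real (1 + x)) = ?Z (1 + of_real x) / of_real x"
        using that by (subst z) auto
      also have "zeta (Complex (1 + x) t) = ?Z (s + of_real x) / Complex x t"
        using that by (subst z) (simp_all add: s_eq shift)
      also have "zeta (Complex (1 + x) (2 * t)) = ?Z (Complex 1 (2 * t) + of_real x) / Complex x (2 * t)"
        using that by (subst z) (simp_all add: shift)
      finally show ?thesis
        using that by (simp add: norm_divide power_divide field_simps eval_nat_numeral)
    qed
    have cont: "((\<lambda>x. ?Z (w + of_real x)) \<longlongrightarrow> ?Z w) (at_right 0)" if "Re w = 1" for w
    proof -
      have "isCont ?Z w"
        using that by (intro field_differentiable_imp_continuous_at zeta_regularized_term_sums(2)) simp
      moreover have "((\<lambda>x. w + of_real x) \<longlongrightarrow> w + of_real 0) (at_right (0::real))"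
        by (intro tendsto_intros)
      ultimately show ?thesis using isCont_tendsto_compose by fastforce
    qed
    obtain D where "(?Z has_field_derivative D) (at s)"
      using zeta_regularized_term_sums(2)[of s] s by (auto simp: field_differentiable_def)
    then have "((\<lambda>h. ?Z (s + h) / h) \<longlongrightarrow> D) (at 0)"
      using zero by (simp add: DERIV_def)
    moreover have "filterlim complex_of_real (at 0) (at_right 0)"
      unfolding filterlim_at
      by (auto intro!: tendsto_eq_intros simp: eventually_at_filter)
    ultimately have D: "((\<lambda>x. ?Z (s + of_real x) / of_real x) \<longlongrightarrow> D) (at_right (0::real))"
      by (rule filterlim_compose)
    have C: "((\<lambda>x. Complex x c) \<longlongrightarrow> Complex 0 c) (at_right 0)" for c
      by (intro tendsto_Complex tendsto_intros)
    have "(?q \<longlongrightarrow> 0 * (cmod (?Z 1) ^ 3 * cmod D ^ 4 / cmod (Complex 0 t) ^ 4 *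
       cmod (?Z (Complex 1 (2 * t))) / cmod (Complex 0 (2 * t)))) (at_right 0)"
      by (intro tendsto_intros cont D C) (use \<open>t \<noteq> 0\<close> in \<open>auto simp: complex_eq_iff\<close>)
    then have "1 \<le> (0 :: real)"
      using ge by (intro tendsto_lowerbound[of ?q 0 "at_right 0" 1]) (auto simp: eventually_at_filter)
    then show False by simp
  qed
qed

section \<open>Newman's contour argument\<close>

lemma powr_diff_mvt:
  fixes t :: real assumes "0 < t"
  shows "\<exists>\<xi>. t < \<xi> \<and> \<xi> < t + 1 \<and> (t + 1) powr c - t powr c = c * \<xi> powr (c - 1)"
proof -
  have "\<exists>\<xi>. t < \<xi> \<and> \<xi> < t + 1 \<and>
      (t + 1) powr c - t powr c = (t + 1 - t) * (c * \<xi> powr (c - 1))"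
    using assms by (intro MVT2) (auto intro!: has_real_derivative_powr)
  then show ?thesis by simp
qed

text \<open>This bound and the next one estimate the tail and the partial sums of a Dirichlet series with bounded
coefficients on the two sides of the line \<open>Re z = 0\<close>. The blow-up like \<open>1 / \<bar>Re z\<bar>\<close> is
cancelled on the contour by the zero of the kernel \<open>(1 + z\<^sup>2 / R\<^sup>2) / z\<close> there.\<close>

lemma sum_powr_tail_le:
  assumes "1 \<le> N" "0 < x"
  shows "(\<Sum>n=N..<N + k. real (Suc n) powr (-1 - x)) \<le> real N powr (-x) / x"
proof -
  have "(\<Sum>n=N..<N + k. real (Suc n) powr (-1 - x)) \<le> (real N powr (-x) - real (N + k) powr (-x)) / x"
  proof (induction k)
    case (Suc k)
    obtain \<xi> where \<xi>: "real (N + k) < \<xi>" "\<xi> < real (N + k) + 1"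
      "(real (N + k) + 1) powr (-x) - real (N + k) powr (-x) = (-x) * \<xi> powr (-x - 1)"
      using powr_diff_mvt[of "real (N + k)" "-x"] assms by auto
    have "real (Suc (N + k)) powr (-1 - x) \<le> \<xi> powr (-1 - x)"
      using \<xi> assms by (intro powr_mono2') auto
    also have "\<xi> powr (-1 - x) = \<xi> powr (-x - 1)" by (rule arg_cong[where f = "\<lambda>u. \<xi> powr u"]) simp
    also have "\<dots> = (real (N + k) powr (-x) - real (N + Suc k) powr (-x)) / x"
      using \<xi>(3) assms by (simp add: field_simps)
    finally show ?case using Suc by (simp add: diff_divide_distrib)
  qed auto
  also have "\<dots> \<le> real N powr (-x) / x" using assms by (intro divide_right_mono) auto
  finally show ?thesis .
qed

lemma sum_powr_le:
  assumes "1 \<le> N" "0 < y"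
  shows "(\<Sum>n<N. real (Suc n) powr (y - 1)) \<le> real N powr y * (1 / y + 1 / real N)"
proof -
  have incr: "\<exists>\<xi>. real N < \<xi> \<and> \<xi> < real (Suc N) \<and>
      real (Suc N) powr y / y = real N powr y / y + \<xi> powr (y - 1)" if N: "1 \<le> N" for N
  proof -
    have "0 < real N" using N by simp
    from powr_diff_mvt[OF this, of y] obtain \<xi> where "real N < \<xi>" "\<xi> < real N + 1"
      "(real N + 1) powr y - real N powr y = y * \<xi> powr (y - 1)"
      using powr_diff_mvt[of "real N" y] that by auto
    then show ?thesis using assms by (intro exI[of _ \<xi>]) (auto simp: field_simps)
  qed
  have shift: "real N powr y / real N = real N powr (y - 1)" if "1 \<le> N" for N
    using that by (simp add: powr_diff)
  show ?thesis
  proof (cases "y \<le> 1")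
    case True
    have "(\<Sum>n<N. real (Suc n) powr (y - 1)) \<le> real N powr y / y"
      using assms(1)
    proof (induction N rule: dec_induct)
      case base
      then show ?case using assms True by (simp add: field_simps)
    next
      case (step N)
      obtain \<xi> where \<xi>: "real N < \<xi>" "\<xi> < real (Suc N)"
        "real (Suc N) powr y / y = real N powr y / y + \<xi> powr (y - 1)"
        using incr[of N] step by blast
      have "real (Suc N) powr (y - 1) \<le> \<xi> powr (y - 1)"
        using \<xi> True step by (intro powr_mono2') auto
      then show ?case using step \<xi>(3) by simp
    qed
    also have "\<dots> \<le> real N powr y * (1 / y + 1 / real N)" by (simp add: algebra_simps)
    finally show ?thesis .
  next
    case False
    have "(\<Sum>n<N. real (Suc n) powr (y - 1)) \<le> real N powr y / y + real N powr (y - 1)"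
      using assms(1)
    proof (induction N rule: dec_induct)
      case base
      then show ?case using assms by (simp add: field_simps)
    next
      case (step N)
      obtain \<xi> where \<xi>: "real N < \<xi>" "\<xi> < real (Suc N)"
        "real (Suc N) powr y / y = real N powr y / y + \<xi> powr (y - 1)"
        using incr[of N] step by blast
      have "real N powr (y - 1) \<le> \<xi> powr (y - 1)"
        using \<xi> False by (intro powr_mono2) auto
      then show ?case using step \<xi>(3) by simp
    qed
    then show ?thesis using shift[OF assms(1)] by (simp add: algebra_simps)
  qed
qed

lemma norm_kernel_on_circle:
  assumes "cmod z = R" "0 < R"
  shows "cmod ((1 + z\<^sup>2 / of_real (R\<^sup>2)) / z) = 2 * \<bar>Re z\<bar> / R\<^sup>2"
proof -
  have "z \<noteq> 0" using assms by auto
  have "of_real (R\<^sup>2) = z * cnj z" using assms(1) complex_norm_square[of z] by simp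
  then have "(1 + z\<^sup>2 / of_real (R\<^sup>2)) / z = (z + cnj z) / of_real (R\<^sup>2)"
    using \<open>z \<noteq> 0\<close> by (simp add: field_simps power2_eq_square)
  also have "z + cnj z = of_real (2 * Re z)" by (rule complex_add_cnj)
  finally show ?thesis by (simp add: norm_divide norm_mult norm_power)
qed

abbreviation right_arc :: "real \<Rightarrow> real \<Rightarrow> complex" where
  "right_arc R \<equiv> part_circlepath 0 R (- (pi / 2)) (pi / 2)"

abbreviation left_arc :: "real \<Rightarrow> real \<Rightarrow> complex" where
  "left_arc R \<equiv> part_circlepath 0 R (pi / 2) (3 * pi / 2)"

lemma right_arc_image:
  assumes "z \<in> path_image (right_arc R)" "0 < R"
  shows "cmod z = R \<and> 0 \<le> Re z"
proof -
  obtain t where "z = R * cis t" "t \<in> closed_segment (- (pi / 2)) (pi / 2)"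
    using assms(1) by (auto simp: path_image_part_circlepath')
  then show ?thesis
    using assms(2) cos_ge_zero[of t] by (auto simp: norm_mult closed_segment_eq_real_ivl)
qed

lemma left_arc_image:
  assumes "z \<in> path_image (left_arc R)" "0 < R"
  shows "cmod z = R \<and> Re z \<le> 0"
proof -
  obtain t where "z = R * cis t" "t \<in> closed_segment (pi / 2) (3 * pi / 2)"
    using assms(1) by (auto simp: path_image_part_circlepath')
  then show ?thesis
    using assms(2) cos_ge_zero[of "t - pi"]
    by (auto simp: norm_mult closed_segment_eq_real_ivl mult_le_0_iff)
qed

lemma right_arc_ends:
  "pathstart (right_arc R) = - \<i> * of_real R" "pathfinish (right_arc R) = \<i> * of_real R"
proof -
  have "cis (- (pi / 2)) = - \<i>" "cis (pi / 2) = \<i>" by (simp_all add: complex_eq_iff)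
  then show "pathstart (right_arc R) = - \<i> * of_real R" "pathfinish (right_arc R) = \<i> * of_real R"
    by (simp_all only: pathstart_part_circlepath pathfinish_part_circlepath cis_conv_exp[symmetric]) auto
qed

lemma left_arc_ends:
  "pathstart (left_arc R) = \<i> * of_real R" "pathfinish (left_arc R) = - \<i> * of_real R"
proof -
  have "3 * pi / 2 = pi / 2 + pi" by simp
  then have "cis (3 * pi / 2) = - \<i>" "cis (pi / 2) = \<i>"
    by (simp_all only: complex_eq_iff cis.sel cos_periodic_pi sin_periodic_pi) simp_all
  then show "pathstart (left_arc R) = \<i> * of_real R" "pathfinish (left_arc R) = - \<i> * of_real R"
    by (simp_all only: pathstart_part_circlepath pathfinish_part_circlepath cis_conv_exp[symmetric]) auto
qed

lemma contour_integral_inverse_arc: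
  assumes "s < t" "0 < R"
  shows "((\<lambda>z. 1 / z) has_contour_integral \<i> * of_real (t - s)) (part_circlepath 0 R s t)"
proof -
  have "((\<lambda>_. \<i>) has_integral \<i> * of_real (t - s)) {s..t}"
    using has_integral_const_real[of \<i> s t] assms by (simp add: scaleR_conv_of_real mult.commute)
  then show ?thesis
    using assms by (simp add: has_contour_integral_part_circlepath_iff)
qed

lemma cauchy_formula_two_arcs:
  assumes "f holomorphic_on UNIV" "0 < R"
  shows "contour_integral (right_arc R) (\<lambda>z. f z / z) + contour_integral (left_arc R) (\<lambda>z. f z / z)
       = 2 * pi * \<i> * f 0"
proof -
  let ?g = "right_arc R +++ left_arc R"
  have ends: "pathfinish (right_arc R) = pathstart (left_arc R)"
    "pathfinish (left_arc R) = pathstart (right_arc R)"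
    by (simp_all only: right_arc_ends left_arc_ends)
  have valid: "valid_path ?g" using ends by (intro valid_path_join) auto
  have avoid: "0 \<notin> path_image (right_arc R)" "0 \<notin> path_image (left_arc R)"
    using right_arc_image[of 0 R] left_arc_image[of 0 R] assms(2) by auto
  then have avoid_g: "0 \<notin> path_image ?g" using path_image_join_subset by blast
  have "((\<lambda>z. 1 / z) has_contour_integral \<i> * of_real pi + \<i> * of_real pi) ?g"
    using contour_integral_inverse_arc[of "- (pi / 2)" "pi / 2" R]
      contour_integral_inverse_arc[of "pi / 2" "3 * pi / 2" R] assms(2)
    by (intro has_contour_integral_join) (auto simp: field_simps)
  then have "winding_number ?g 0 = 1"
    using winding_number_valid_path[OF valid avoid_g] contour_integral_unique by fastforce
  moreover have "((\<lambda>z. f z / (z - 0)) has_contour_integral 2 * pi * \<i> * winding_number ?g 0 * f 0) ?g"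
    using assms(1) valid avoid_g ends by (intro Cauchy_integral_formula_convex_simple[of UNIV]) auto
  ultimately have "((\<lambda>z. f z / z) has_contour_integral 2 * pi * \<i> * f 0) ?g" by simp
  moreover have "(\<lambda>z. f z / z) contour_integrable_on right_arc R"
    "(\<lambda>z. f z / z) contour_integrable_on left_arc R"
    using avoid continuous_on_subset[OF holomorphic_on_imp_continuous_on[OF assms(1)]]
    by (auto intro!: contour_integrable_continuous_part_circlepath continuous_on_divide continuous_on_id)
  ultimately show ?thesis by (subst contour_integral_join[symmetric]) (auto dest: contour_integral_unique)
qed

lemma norm_dirichlet_tail_le:
  assumes bound: "\<And>n. cmod (a n) \<le> 1" and "1 \<le> N" "0 < Re z"
    and sums: "(\<lambda>n. a (Suc n) * of_nat (Suc n) powr (-1 - z)) sums F"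
  shows "cmod (F - (\<Sum>n<N. a (Suc n) * of_nat (Suc n) powr (-1 - z))) \<le> real N powr (- Re z) / Re z"
proof -
  let ?t = "\<lambda>n. a (Suc n) * of_nat (Suc n) powr (-1 - z)"
  have t: "cmod (?t n) \<le> real (Suc n) powr (-1 - Re z)" for n
  proof -
    have "cmod (?t n) = cmod (a (Suc n)) * real (Suc n) powr (-1 - Re z)"
      unfolding norm_mult norm_nat_powr by simp
    then show ?thesis using mult_right_mono[OF bound[of "Suc n"], of "real (Suc n) powr (-1 - Re z)"]
      by (simp del: of_nat_Suc)
  qed
  have "(\<lambda>k. sum ?t {..<k + N}) \<longlonglongrightarrow> F"
    using sums unfolding sums_def by (rule LIMSEQ_ignore_initial_segment)
  then have "(\<lambda>k. cmod (sum ?t {..<k + N} - sum ?t {..<N})) \<longlonglongrightarrow> cmod (F - sum ?t {..<N})"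
    by (intro tendsto_intros)
  moreover have "cmod (sum ?t {..<k + N} - sum ?t {..<N}) \<le> real N powr (- Re z) / Re z" for k
  proof -
    have "sum ?t {..<k + N} - sum ?t {..<N} = sum ?t {N..<N + k}"
      using sum_diff_nat_ivl[of 0 N "k + N" ?t] by (simp add: atLeast0LessThan add.commute)
    also have "cmod \<dots> \<le> (\<Sum>n=N..<N + k. real (Suc n) powr (-1 - Re z))"
      by (intro sum_norm_le t)
    also have "\<dots> \<le> real N powr (- Re z) / Re z" using assms by (intro sum_powr_tail_le)
    finally show ?thesis .
  qed
  ultimately show ?thesis by (intro LIMSEQ_le_const2) auto
qed

lemma norm_dirichlet_sum_le:
  assumes bound: "\<And>n. cmod (a n) \<le> 1" and "1 \<le> N" "Re z < 0"
  shows "cmod (\<Sum>n<N. a (Suc n) * of_nat (Suc n) powr (-1 - z))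
    \<le> real N powr (- Re z) * (1 / (- Re z) + 1 / real N)"
proof -
  have "cmod (a (Suc n) * of_nat (Suc n) powr (-1 - z)) \<le> real (Suc n) powr (- Re z - 1)" for n
  proof -
    have "cmod (a (Suc n) * of_nat (Suc n) powr (-1 - z)) = cmod (a (Suc n)) * real (Suc n) powr (- Re z - 1)"
      unfolding norm_mult norm_nat_powr by (simp add: minus_diff_commute)
    then show ?thesis using mult_right_mono[OF bound[of "Suc n"], of "real (Suc n) powr (- Re z - 1)"]
      by (simp del: of_nat_Suc)
  qed
  then have "cmod (\<Sum>n<N. a (Suc n) * of_nat (Suc n) powr (-1 - z))
      \<le> (\<Sum>n<N. real (Suc n) powr (- Re z - 1))" by (rule sum_norm_le)
  also have "\<dots> \<le> real N powr (- Re z) * (1 / (- Re z) + 1 / real N)"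
    using assms by (intro sum_powr_le) auto
  finally show ?thesis .
qed

text \<open>Write \<open>S\<close> for the partial sum and \<open>F z = z * G z\<close> for the full series. Integrate against the
kernel \<open>of_nat N powr z * (1 + z\<^sup>2 / R\<^sup>2) / z\<close>. As \<open>S\<close> is entire, its integral over
the circle of radius \<open>R\<close> is \<open>2 * pi * \<i> * S 0\<close>. On the right half circle compare
\<open>S\<close> with \<open>F\<close>; on the left half circle bound \<open>S\<close> directly; each costs about
\<open>2 * pi / R\<close>. Since \<open>F\<close> vanishes at 0, the product of \<open>F\<close> and the kernel has no pole, and
its integral over the right half circle can be moved to the three sides of a rectangle of depth \<open>\<delta>\<close>
on the left. There \<open>N powr Re z\<close> is small on the vertical side, and the horizontal sides are short.\<close>

lemma newman_estimate:
  fixes a :: "nat \<Rightarrow> complex" and G :: "complex \<Rightarrow> complex"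
  assumes bound: "\<And>n. cmod (a n) \<le> 1"
    and sums: "\<And>z. 0 < Re z \<Longrightarrow> (\<lambda>n. a (Suc n) * of_nat (Suc n) powr (-1 - z)) sums (z * G z)"
    and R: "0 < R" and \<delta>: "0 < \<delta>" and N: "1 \<le> N"
    and V: "convex V" "G holomorphic_on V"
      "{z. cmod z \<le> R \<and> 0 \<le> Re z} \<subseteq> V" "{z. - \<delta> \<le> Re z \<and> Re z \<le> 0 \<and> \<bar>Im z\<bar> \<le> R} \<subseteq> V"
    and B: "\<And>z. - \<delta> \<le> Re z \<Longrightarrow> Re z \<le> 0 \<Longrightarrow> \<bar>Im z\<bar> \<le> R \<Longrightarrow>
      cmod (G z * (1 + z\<^sup>2 / of_real (R\<^sup>2))) \<le> B"
  shows "2 * pi * cmod (\<Sum>n<N. a (Suc n) / of_nat (Suc n))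
    \<le> 2 * pi / R + 2 * pi / R * (1 + R / real N) + (2 * B * \<delta> + 2 * R * B * real N powr (- \<delta>))"
proof -
  define S where "S = (\<lambda>z. \<Sum>n<N. a (Suc n) * of_nat (Suc n) powr (-1 - z))"
  define w where "w = (\<lambda>z. 1 + z\<^sup>2 / of_real (R\<^sup>2) :: complex)"
  define K where "K = (\<lambda>z. G z * w z * of_nat N powr z)"
  define f where "f = (\<lambda>z. S z * (w z * of_nat N powr z))"
  define p q :: complex where "p = Complex (- \<delta>) R" "q = Complex (- \<delta>) (- R)"
  have N0: "of_nat N \<noteq> (0 :: complex)" "0 < real N" using N by auto
  have "cmod (G 0 * (1 + 0\<^sup>2 / of_real (R\<^sup>2))) \<le> B" by (rule B) (use R \<delta> in auto)
  then have B0: "0 \<le> B" by (meson norm_ge_zero order_trans)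
  have wN: "(\<lambda>z. w z * of_nat N powr z) holomorphic_on X" for X
    unfolding w_def using R
    by (intro holomorphic_on_mult holomorphic_on_add holomorphic_on_divide holomorphic_on_power
        holomorphic_on_powr_right holomorphic_on_ident holomorphic_on_const) auto
  have f_hol: "f holomorphic_on X" for X
    unfolding f_def S_def
    by (intro holomorphic_on_mult holomorphic_on_sum holomorphic_on_diff
        holomorphic_on_powr_right holomorphic_on_ident holomorphic_on_const wN)
  have K_hol: "K holomorphic_on V"
    unfolding K_def mult.assoc by (intro holomorphic_on_mult V wN)
  note arcR = right_arc_image[OF _ R] and arcL = left_arc_image[OF _ R]
  have rect: "z \<in> V" if "- \<delta> \<le> Re z" "Re z \<le> 0" "\<bar>Im z\<bar> \<le> R" for z using V(4) that by auto
  have seg1: "- \<delta> \<le> Re z \<and> Re z \<le> 0 \<and> \<bar>Im z\<bar> \<le> R" if "z \<in> closed_segment (\<i> * of_real R) p" for z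
  proof -
    have "z \<in> {z. - \<delta> \<le> Re z} \<inter> {z. Re z \<le> 0} \<inter> ({z. Im z \<le> R} \<inter> {z. - R \<le> Im z})"
      by (rule subsetD[OF closed_segment_subset that])
        (use R \<delta> in \<open>auto simp: p_q_def intro!: convex_Int convex_halfspace_Re_le convex_halfspace_Re_ge
            convex_halfspace_Im_le convex_halfspace_Im_ge\<close>)
    then show ?thesis by auto
  qed
  have seg2: "Re z = - \<delta> \<and> \<bar>Im z\<bar> \<le> R" if "z \<in> closed_segment p q" for z
  proof -
    have "z \<in> {z. - \<delta> \<le> Re z} \<inter> {z. Re z \<le> - \<delta>} \<inter> ({z. Im z \<le> R} \<inter> {z. - R \<le> Im z})"
      by (rule subsetD[OF closed_segment_subset that])
        (use R \<delta> in \<open>auto simp: p_q_def intro!: convex_Int convex_halfspace_Re_le convex_halfspace_Re_ge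
            convex_halfspace_Im_le convex_halfspace_Im_ge\<close>)
    then show ?thesis by auto
  qed
  have seg3: "- \<delta> \<le> Re z \<and> Re z \<le> 0 \<and> \<bar>Im z\<bar> \<le> R" if "z \<in> closed_segment q (- \<i> * of_real R)" for z
  proof -
    have "z \<in> {z. - \<delta> \<le> Re z} \<inter> {z. Re z \<le> 0} \<inter> ({z. Im z \<le> R} \<inter> {z. - R \<le> Im z})"
      by (rule subsetD[OF closed_segment_subset that])
        (use R \<delta> in \<open>auto simp: p_q_def intro!: convex_Int convex_halfspace_Re_le convex_halfspace_Re_ge
            convex_halfspace_Im_le convex_halfspace_Im_ge\<close>)
    then show ?thesis by auto
  qed
  have inV: "path_image (right_arc R) \<subseteq> V" "closed_segment (\<i> * of_real R) p \<subseteq> V"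
    "closed_segment p q \<subseteq> V" "closed_segment q (- \<i> * of_real R) \<subseteq> V"
    using arcR V(3) seg1 seg2 seg3 rect \<delta> by fastforce+
  have K_cont: "continuous_on X K" if "X \<subseteq> V" for X
    using holomorphic_on_imp_continuous_on[OF K_hol] that by (rule continuous_on_subset)
  have K_int: "K contour_integrable_on right_arc R" "K contour_integrable_on linepath (\<i> * of_real R) p"
    "K contour_integrable_on linepath p q" "K contour_integrable_on linepath q (- \<i> * of_real R)"
    by (intro contour_integrable_continuous_part_circlepath contour_integrable_continuous_linepath
        K_cont inV)+
  let ?L = "linepath (\<i> * of_real R) p +++ (linepath p q +++ linepath q (- \<i> * of_real R))"
  have "(K has_contour_integral 0) (right_arc R +++ ?L)"
  proof (rule Cauchy_theorem_convex_simple[OF K_hol V(1)])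
    show "valid_path (right_arc R +++ ?L)"
      by (intro valid_path_join valid_path_part_circlepath valid_path_linepath)
         (simp_all only: right_arc_ends pathstart_join pathfinish_join pathstart_linepath pathfinish_linepath)
    show "path_image (right_arc R +++ ?L) \<subseteq> V"
      by (intro subset_path_image_join) (simp_all only: path_image_linepath inV)
  qed (simp only: right_arc_ends pathstart_join pathfinish_join pathstart_linepath pathfinish_linepath)
  then have "contour_integral (right_arc R +++ ?L) K = 0" by (rule contour_integral_unique)
  then have "contour_integral (right_arc R) K + (contour_integral (linepath (\<i> * of_real R) p) K
      + (contour_integral (linepath p q) K + contour_integral (linepath q (- \<i> * of_real R)) K)) = 0"
    using K_int by (simp add: valid_path_join)
  then have "contour_integral (right_arc R) K = - (contour_integral (linepath (\<i> * of_real R) p) K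
      + (contour_integral (linepath p q) K + contour_integral (linepath q (- \<i> * of_real R)) K))"
    by (simp only: eq_neg_iff_add_eq_0)
  then have K_right: "cmod (contour_integral (right_arc R) K)
     \<le> cmod (contour_integral (linepath (\<i> * of_real R) p) K)
      + (cmod (contour_integral (linepath p q) K) + cmod (contour_integral (linepath q (- \<i> * of_real R)) K))"
    by (simp only: norm_minus_cancel) (intro norm_triangle_mono norm_triangle_ineq order_refl)
  have K_bound: "cmod (K z) \<le> B * real N powr Re z" if "- \<delta> \<le> Re z" "Re z \<le> 0" "\<bar>Im z\<bar> \<le> R" for z
    using mult_right_mono[OF B[OF that], of "real N powr Re z"]
    by (simp add: K_def w_def norm_mult norm_nat_powr)
  have K_bound1: "cmod (K z) \<le> B" if "- \<delta> \<le> Re z" "Re z \<le> 0" "\<bar>Im z\<bar> \<le> R" for z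
  proof -
    have "real N powr Re z \<le> 1" using powr_mono[of "Re z" 0 "real N"] that N by simp
    then show ?thesis using K_bound[OF that] B0 mult_left_le[of "real N powr Re z" B] by linarith
  qed
  have len: "cmod (p - \<i> * of_real R) = \<delta>" "cmod (- \<i> * of_real R - q) = \<delta>" "cmod (q - p) = 2 * R"
    using R \<delta> by (simp_all add: p_q_def cmod_def real_sqrt_mult)
  have "cmod (contour_integral (linepath (\<i> * of_real R) p) K) \<le> B * \<delta>"
    using contour_integral_bound_linepath[OF K_int(2) B0] seg1 K_bound1 len by auto
  moreover have "cmod (contour_integral (linepath q (- \<i> * of_real R)) K) \<le> B * \<delta>"
    using contour_integral_bound_linepath[OF K_int(4) B0] seg3 K_bound1 len by auto
  moreover have "cmod (contour_integral (linepath p q) K) \<le> (B * real N powr (- \<delta>)) * (2 * R)"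
    unfolding len(3)[symmetric]
  proof (rule contour_integral_bound_linepath[OF K_int(3)])
    fix z assume "z \<in> closed_segment p q"
    from seg2[OF this] show "cmod (K z) \<le> B * real N powr (- \<delta>)"
      using K_bound[of z] \<delta> by auto
  qed (use B0 in auto)
  ultimately have right_K: "cmod (contour_integral (right_arc R) K)
      \<le> 2 * B * \<delta> + 2 * R * B * real N powr (- \<delta>)"
    using K_right by (simp add: algebra_simps)
  have f_int: "(\<lambda>z. f z / z) contour_integrable_on part_circlepath 0 R s t"
    if "0 \<notin> path_image (part_circlepath 0 R s t)" for s t
    using that by (intro contour_integrable_continuous_part_circlepath continuous_on_divide
        holomorphic_on_imp_continuous_on[OF f_hol] continuous_on_id) auto
  have f_int_right: "(\<lambda>z. f z / z) contour_integrable_on right_arc R"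
    by (rule f_int) (use arcR[of 0] R in auto)
  have f_int_left: "(\<lambda>z. f z / z) contour_integrable_on left_arc R"
    by (rule f_int) (use arcL[of 0] R in auto)
  have kernel: "cmod (w z / z * of_nat N powr z) = 2 * \<bar>Re z\<bar> / R\<^sup>2 * real N powr Re z" if "cmod z = R" for z
    by (subst norm_mult) (simp only: norm_nat_powr w_def norm_kernel_on_circle[OF that R])
  have "cmod (contour_integral (right_arc R) (\<lambda>z. K z - f z / z)) \<le> 2 / R\<^sup>2 * R * \<bar>pi / 2 - - (pi / 2)\<bar>"
  proof (rule contour_integral_bound_part_circlepath)
    show "(\<lambda>z. K z - f z / z) contour_integrable_on right_arc R"
      using K_int(1) f_int_right by (rule contour_integrable_diff)
    fix z assume "z \<in> path_image (right_arc R)"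
    then have z: "cmod z = R" "0 \<le> Re z" "z \<noteq> 0" using arcR[of z] R by auto
    have eq: "cmod (K z - f z / z) = cmod (z * G z - S z) * (2 * Re z / R\<^sup>2 * real N powr Re z)"
    proof -
      have "K z - f z / z = (z * G z - S z) * (w z / z * of_nat N powr z)"
        using z by (simp add: K_def f_def field_simps)
      then show ?thesis
        by (simp only: norm_mult[of "z * G z - S z"] kernel[OF z(1)] abs_of_nonneg[OF z(2)])
    qed
    show "cmod (K z - f z / z) \<le> 2 / R\<^sup>2"
    proof (cases "Re z = 0")
      case False
      then have pos: "0 < Re z" using z by simp
      have "cmod (K z - f z / z) \<le> real N powr (- Re z) / Re z * (2 * Re z / R\<^sup>2 * real N powr Re z)"
        unfolding eq S_def
        by (rule mult_right_mono[OF norm_dirichlet_tail_le[OF bound N pos sums[OF pos]]]) (use pos in auto)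
      also have "\<dots> = 2 / R\<^sup>2" using pos N0 by (simp add: powr_minus field_simps)
      finally show ?thesis .
    next
      case True
      then have "cmod (K z - f z / z) = 0" unfolding eq by simp
      then show ?thesis by (rule ord_eq_le_trans) simp
    qed
  qed (use R in auto)
  then have right: "cmod (contour_integral (right_arc R) K - contour_integral (right_arc R) (\<lambda>z. f z / z)) \<le> 2 * pi / R"
    using R by (simp add: contour_integral_diff K_int f_int_right power2_eq_square)
  have "cmod (contour_integral (left_arc R) (\<lambda>z. f z / z)) \<le> 2 / R\<^sup>2 * (1 + R / real N) * R * \<bar>3 * pi / 2 - pi / 2\<bar>"
  proof (rule contour_integral_bound_part_circlepath[OF f_int_left])
    fix z assume "z \<in> path_image (left_arc R)"
    then have z: "cmod z = R" "Re z \<le> 0" "z \<noteq> 0" using arcL[of z] R by auto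
    have eq: "cmod (f z / z) = cmod (S z) * (2 * (- Re z) / R\<^sup>2 * real N powr Re z)"
    proof -
      have "f z / z = S z * (w z / z * of_nat N powr z)" by (simp add: f_def)
      then show ?thesis
        by (simp only: norm_mult[of "S z"] kernel[OF z(1)] abs_of_nonpos[OF z(2)])
    qed
    show "cmod (f z / z) \<le> 2 / R\<^sup>2 * (1 + R / real N)"
    proof (cases "Re z = 0")
      case False
      then have neg: "Re z < 0" using z by simp
      have gen: "1 / E * (1 / y + 1 / m) * (2 * y / R\<^sup>2 * E) = 2 / R\<^sup>2 * (1 + y / m)"
        if "0 < E" "0 < y" "0 < m" for E y m :: real
        using that R by (simp add: field_simps)
      have "cmod (f z / z) \<le> real N powr (- Re z) * (1 / (- Re z) + 1 / real N) *
          (2 * (- Re z) / R\<^sup>2 * real N powr Re z)"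
        unfolding eq S_def
        by (rule mult_right_mono[OF norm_dirichlet_sum_le[OF bound N neg]],
            intro mult_nonneg_nonneg divide_nonneg_nonneg) (use neg in simp_all)
      also have "\<dots> = 2 / R\<^sup>2 * (1 + (- Re z) / real N)"
        using gen[of "real N powr Re z" "- Re z" "real N"] neg N0 by (simp only: powr_minus_divide) simp
      also have "\<dots> \<le> 2 / R\<^sup>2 * (1 + R / real N)"
        using abs_Re_le_cmod[of z] z R by (intro mult_left_mono add_left_mono divide_right_mono) auto
      finally show ?thesis .
    next
      case True
      then have "cmod (f z / z) = 0" unfolding eq by simp
      then show ?thesis by (rule ord_eq_le_trans) (use R in simp)
    qed
  qed (use R in auto)
  also have "2 / R\<^sup>2 * (1 + R / real N) * R * \<bar>3 * pi / 2 - pi / 2\<bar> = 2 * pi / R * (1 + R / real N)"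
    using R by (simp add: power2_eq_square)
  finally have left: "cmod (contour_integral (left_arc R) (\<lambda>z. f z / z)) \<le> 2 * pi / R * (1 + R / real N)" .
  have "f 0 = (\<Sum>n<N. a (Suc n) / of_nat (Suc n))"
  proof -
    have "of_nat (Suc n) powr (-1) = inverse (of_nat (Suc n) :: complex)" for n
      using of_nat_neq_0[of n, where 'a = complex] by (simp add: powr_minus powr_to_1 del: of_nat_Suc)
    then show ?thesis using N0 by (simp add: f_def S_def w_def divide_inverse del: of_nat_Suc)
  qed
  then have "2 * pi * cmod (\<Sum>n<N. a (Suc n) / of_nat (Suc n)) = cmod (2 * pi * \<i> * f 0)"
    by (simp add: norm_mult)
  also have "2 * pi * \<i> * f 0 = contour_integral (right_arc R) K
      - (contour_integral (right_arc R) K - contour_integral (right_arc R) (\<lambda>z. f z / z))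
      + contour_integral (left_arc R) (\<lambda>z. f z / z)"
    using cauchy_formula_two_arcs[OF f_hol R] by simp
  also have "cmod \<dots> \<le> cmod (contour_integral (right_arc R) K)
      + cmod (contour_integral (right_arc R) K - contour_integral (right_arc R) (\<lambda>z. f z / z))
      + cmod (contour_integral (left_arc R) (\<lambda>z. f z / z))"
    by (intro norm_triangle_mono norm_triangle_ineq4 order_refl)
  also have "\<dots> \<le> 2 * pi / R + 2 * pi / R * (1 + R / real N) + (2 * B * \<delta> + 2 * R * B * real N powr (- \<delta>))"
    using right_K right left by simp
  finally show ?thesis .
qed

text \<open>In the preceding estimate choose first \<open>R\<close> large, then \<open>\<delta>\<close> small, then \<open>N\<close> large.
Compactness of the half disc gives a convex neighbourhood on which \<open>G\<close> is holomorphic.\<close>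

theorem newman:
  fixes a :: "nat \<Rightarrow> complex" and G :: "complex \<Rightarrow> complex"
  assumes bound: "\<And>n. cmod (a n) \<le> 1"
    and sums: "\<And>z. 0 < Re z \<Longrightarrow> (\<lambda>n. a (Suc n) * of_nat (Suc n) powr (-1 - z)) sums (z * G z)"
    and U: "open U" "{z. 0 \<le> Re z} \<subseteq> U" "G holomorphic_on U"
  shows "(\<lambda>N. \<Sum>n<N. a (Suc n) / of_nat (Suc n)) \<longlonglongrightarrow> 0"
proof (rule LIMSEQ_I)
  fix r :: real assume r: "0 < r"
  \<comment> \<open>The two half circles then contribute \<open>4 * pi / R = pi * r\<close>, which leaves room below \<open>2 * pi * r\<close> for \<open>2 * r\<close> from the horizontal sides.\<close>
  define R where "R = 4 / r"
  have R: "0 < R" using r by (simp add: R_def)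
  define H where "H = {z. cmod z \<le> R \<and> 0 \<le> Re z}"
  have H_eq: "H = cball 0 R \<inter> {z. Re z \<ge> 0}" by (auto simp: H_def)
  have H: "compact H" "convex H" unfolding H_eq
    by (auto intro!: compact_Int_closed closed_halfspace_Re_ge convex_Int convex_halfspace_Re_ge)
  obtain \<epsilon> where \<epsilon>: "0 < \<epsilon>" "(\<Union>x\<in>H. ball x \<epsilon>) \<subseteq> U"
    using compact_subset_open_imp_ball_epsilon_subset[OF H(1) U(1)] U(2) by (auto simp: H_def)
  \<comment> \<open>The sum of two convex sets, hence convex.\<close>
  define V where "V = (\<Union>x\<in>H. \<Union>y\<in>ball 0 \<epsilon>. {x + y})"
  have V_I: "x + y \<in> V" if "x \<in> H" "cmod y < \<epsilon>" for x y
    using that unfolding V_def by (intro UN_I[of x] UN_I[of y]) simp_all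
  have "V \<subseteq> U"
  proof
    fix z assume "z \<in> V"
    then obtain x y where xy: "x \<in> H" "cmod y < \<epsilon>" "z = x + y" unfolding V_def by auto
    then have "z \<in> ball x \<epsilon>" by (simp add: dist_norm)
    then show "z \<in> U" using xy(1) \<epsilon>(2) by blast
  qed
  then have V: "convex V" "G holomorphic_on V"
    using convex_sums[OF H(2) convex_ball, of 0 \<epsilon>] holomorphic_on_subset[OF U(3)]
    unfolding V_def[symmetric] by simp_all
  have rectV: "{z. - d \<le> Re z \<and> Re z \<le> 0 \<and> \<bar>Im z\<bar> \<le> R} \<subseteq> V" if "d < \<epsilon>" for d
  proof
    fix z assume z: "z \<in> {z. - d \<le> Re z \<and> Re z \<le> 0 \<and> \<bar>Im z\<bar> \<le> R}"
    have "Complex 0 (Im z) \<in> H" using z by (simp add: H_def cmod_def)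
    moreover have "cmod (of_real (Re z)) < \<epsilon>" using z that by simp
    ultimately have "Complex 0 (Im z) + of_real (Re z) \<in> V" by (rule V_I)
    moreover have "Complex 0 (Im z) + of_real (Re z) = z" by (simp add: complex_eq_iff)
    ultimately show "z \<in> V" by simp
  qed
  have HV: "H \<subseteq> V" using V_I[of _ 0] \<epsilon>(1) by auto
  define \<delta>0 where "\<delta>0 = \<epsilon> / 2"
  define Q where "Q = cbox (Complex (- \<delta>0) (- R)) (Complex 0 R)"
  have Q: "z \<in> Q \<longleftrightarrow> - \<delta>0 \<le> Re z \<and> Re z \<le> 0 \<and> \<bar>Im z\<bar> \<le> R" for z
    by (auto simp: Q_def in_cbox_complex_iff)
  have "Q \<subseteq> V" using rectV[of \<delta>0] \<epsilon>(1) Q by (auto simp: \<delta>0_def)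
  have "continuous_on Q (\<lambda>z. G z * (1 + z\<^sup>2 / of_real (R\<^sup>2)))"
    by (intro continuous_intros continuous_on_subset[OF holomorphic_on_imp_continuous_on[OF V(2)] \<open>Q \<subseteq> V\<close>])
       (use R in auto)
  then have "compact ((\<lambda>z. G z * (1 + z\<^sup>2 / of_real (R\<^sup>2))) ` Q)"
    by (rule compact_continuous_image) (simp add: Q_def)
  then obtain B where B: "0 < B" "\<And>z. z \<in> Q \<Longrightarrow> cmod (G z * (1 + z\<^sup>2 / of_real (R\<^sup>2))) \<le> B"
    using compact_imp_bounded bounded_pos by (metis (no_types, lifting) imageI)
  define \<delta> where "\<delta> = min \<delta>0 (r / B)"
  have \<delta>: "0 < \<delta>" "\<delta> \<le> \<delta>0" "B * \<delta> \<le> r"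
    using \<epsilon>(1) r B(1) by (auto simp: \<delta>_def \<delta>0_def min_def field_simps)
  have "2 * pi * cmod (\<Sum>n<N. a (Suc n) / of_nat (Suc n))
      \<le> 2 * pi / R + 2 * pi / R * (1 + R / real N) + (2 * B * \<delta> + 2 * R * B * real N powr (- \<delta>))"
    if "1 \<le> N" for N
  proof (rule newman_estimate[OF bound sums R \<delta>(1) that V])
    show "{z. cmod z \<le> R \<and> 0 \<le> Re z} \<subseteq> V" using HV by (simp add: H_def)
    show "{z. - \<delta> \<le> Re z \<and> Re z \<le> 0 \<and> \<bar>Im z\<bar> \<le> R} \<subseteq> V"
      by (rule rectV) (use \<delta>(2) \<epsilon>(1) in \<open>simp add: \<delta>0_def\<close>)
    show "cmod (G z * (1 + z\<^sup>2 / of_real (R\<^sup>2))) \<le> B"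
      if "- \<delta> \<le> Re z" "Re z \<le> 0" "\<bar>Im z\<bar> \<le> R" for z
      by (rule B(2)) (use that \<delta>(2) Q in auto)
  qed
  then have est: "2 * pi * cmod (\<Sum>n<N. a (Suc n) / of_nat (Suc n))
      \<le> 2 * pi / R + 2 * pi / R * (1 + R / real N) + (2 * r + 2 * R * B * real N powr (- \<delta>))"
    if "1 \<le> N" for N using that \<delta>(3) by fastforce
  have "(\<lambda>N. real N powr (- \<delta>)) \<longlonglongrightarrow> 0"
    using \<delta>(1) by (intro tendsto_neg_powr filterlim_real_sequentially) auto
  then have "(\<lambda>N. 2 * pi / R + 2 * pi / R * (1 + R / real N) + (2 * r + 2 * R * B * real N powr (- \<delta>)))
      \<longlonglongrightarrow> 2 * pi / R + 2 * pi / R * (1 + 0) + (2 * r + 2 * R * B * 0)"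
    by (intro tendsto_intros lim_const_over_n)
  also have "2 * pi / R + 2 * pi / R * (1 + 0) + (2 * r + 2 * R * B * 0) = pi * r + 2 * r"
    using r by (simp add: R_def)
  finally have "\<forall>\<^sub>F N in sequentially.
      2 * pi / R + 2 * pi / R * (1 + R / real N) + (2 * r + 2 * R * B * real N powr (- \<delta>)) < 2 * pi * r"
    using r pi_gt3 by (intro order_tendstoD(2)) (auto simp: algebra_simps)
  then have "\<forall>\<^sub>F N in sequentially. cmod (\<Sum>n<N. a (Suc n) / of_nat (Suc n)) < r"
    using eventually_ge_at_top[of 1]
  proof eventually_elim
    case (elim N)
    then have "2 * pi * cmod (\<Sum>n<N. a (Suc n) / of_nat (Suc n)) < 2 * pi * r" using est[of N] by linarith
    then show ?case by simp
  qed
  then show "\<exists>no. \<forall>N\<ge>no. norm ((\<Sum>n<N. a (Suc n) / of_nat (Suc n)) - 0) < r"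
    by (simp add: eventually_sequentially)
qed

section \<open>The Moebius function on average\<close>

definition moebius_mu :: "nat \<Rightarrow> real" where
  "moebius_mu n = (if squarefree n then (-1) ^ card (prime_factors n) else 0)"

lemma abs_moebius_le: "\<bar>moebius_mu n\<bar> \<le> 1"
  by (simp add: moebius_mu_def)

lemma moebius_1: "moebius_mu (Suc 0) = 1"
  by (simp add: moebius_mu_def)

lemma moebius_prime_mult:
  assumes "prime p" and "0 < n"
  shows "moebius_mu (p * n) = (if p dvd n then 0 else - moebius_mu n)"
proof (cases "p dvd n")
  case True
  then have "p\<^sup>2 dvd p * n" by (auto simp: power2_eq_square)
  then have "\<not> squarefree (p * n)"
    using assms(1) not_prime_unit squarefreeD by blast
  then show ?thesis using True by (simp add: moebius_mu_def)
next
  case False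
  then have "coprime p n" using assms(1) by (simp add: prime_imp_coprime)
  then have "squarefree (p * n) \<longleftrightarrow> squarefree n"
    using squarefree_mult_coprime[of p n] squarefree_multD[of p n] squarefree_prime[OF assms(1)] by blast
  moreover have "prime_factors (p * n) = insert p (prime_factors n)"
    using assms by (auto simp: prime_factors_product prime_prime_factors)
  moreover have "p \<notin> prime_factors n" using False by auto
  ultimately show ?thesis using False by (simp add: moebius_mu_def)
qed

text \<open>For a prime \<open>p\<close> dividing \<open>n\<close>, the divisors \<open>d\<close> prime to \<open>p\<close> cancel against
the divisors \<open>p * d\<close>, and the remaining divisors are not squarefree.\<close>

lemma sum_moebius_divisors:
  assumes "0 < n"
  shows "(\<Sum>d | d dvd n. moebius_mu d) = (if n = 1 then 1 else 0)"
proof (cases "n = 1")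
  case True
  then show ?thesis by (simp add: moebius_1)
next
  case False
  then obtain p where p: "prime p" "p dvd n" using prime_factor_nat by blast
  define E where "E = {d. d dvd n \<and> \<not> p dvd d}"
  have fin: "finite {d. d dvd n}" using assms by simp
  then have "finite E" by (rule finite_subset[rotated]) (auto simp: E_def)
  have pos: "0 < d" if "d dvd n" for d using that assms by (auto intro: Nat.gr0I)
  have image: "(\<lambda>d. p * d) ` E \<subseteq> {d. d dvd n \<and> p dvd d}"
  proof
    fix x assume "x \<in> (\<lambda>d. p * d) ` E"
    then obtain d where d: "x = p * d" "d dvd n" "\<not> p dvd d" by (auto simp: E_def)
    then have "coprime p d" using p(1) by (simp add: prime_imp_coprime)
    then show "x \<in> {d. d dvd n \<and> p dvd d}" using d p(2) by (simp add: divides_mult)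
  qed
  have "(\<Sum>d | d dvd n \<and> p dvd d. moebius_mu d) = (\<Sum>d\<in>(\<lambda>d. p * d) ` E. moebius_mu d)"
  proof (rule sum.mono_neutral_right)
    show "finite {d. d dvd n \<and> p dvd d}" using fin by (rule finite_subset[rotated]) auto
    show "\<forall>x\<in>{d. d dvd n \<and> p dvd d} - (\<lambda>d. p * d) ` E. moebius_mu x = 0"
    proof
      fix x assume x: "x \<in> {d. d dvd n \<and> p dvd d} - (\<lambda>d. p * d) ` E"
      then obtain d where d: "x = p * d" by auto
      then have "d dvd n" using x by (auto intro: dvd_trans[of d x n])
      then have "p dvd d" using x d by (auto simp: E_def)
      then show "moebius_mu x = 0" using moebius_prime_mult[OF p(1) pos[OF \<open>d dvd n\<close>]] d by simp
    qed
  qed (rule image)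
  also have "\<dots> = (\<Sum>d\<in>E. moebius_mu (p * d))"
    using p(1) prime_gt_0_nat by (subst sum.reindex) (auto simp: inj_on_def)
  also have "\<dots> = (\<Sum>d\<in>E. - moebius_mu d)"
    using moebius_prime_mult[OF p(1)] pos by (intro sum.cong) (auto simp: E_def)
  finally have "(\<Sum>d | d dvd n \<and> p dvd d. moebius_mu d) = - (\<Sum>d\<in>E. moebius_mu d)"
    by (simp add: sum_negf)
  moreover have "(\<Sum>d | d dvd n. moebius_mu d)
      = (\<Sum>d | d dvd n \<and> p dvd d. moebius_mu d) + (\<Sum>d\<in>E. moebius_mu d)"
  proof -
    have "{d. d dvd n} = {d. d dvd n \<and> p dvd d} \<union> E" by (auto simp: E_def)
    moreover have "{d. d dvd n \<and> p dvd d} \<inter> E = {}" by (auto simp: E_def)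
    moreover have "finite {d. d dvd n \<and> p dvd d}" using fin by (rule finite_subset[rotated]) auto
    ultimately show ?thesis using \<open>finite E\<close> by (simp add: sum.union_disjoint)
  qed
  ultimately show ?thesis using False by simp
qed

lemma moebius_series_mult_zeta:
  assumes s: "1 < Re s"
  shows "zeta s * (\<Sum>\<^sub>\<infinity>d\<in>{1..}. of_real (moebius_mu d) * of_nat d powr (-s)) = 1"
proof -
  let ?f = "\<lambda>n. of_nat n powr (-s) :: complex"
  let ?m = "\<lambda>d. complex_of_real (moebius_mu d)"
  define g where "g = (\<lambda>(k, d). ?f k * (?m d * ?f d))"
  let ?A = "{1::nat..}"
  have m_summable: "(\<lambda>d. cmod (?m d * ?f d)) summable_on B" for B
    using bounded_dirichlet_abs_summable_on[OF s, of ?m] abs_moebius_le by simp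
  have "(\<lambda>x. cmod (g x)) summable_on (Sigma ?A (\<lambda>_. ?A))"
  proof (subst Infinite_Sum.abs_summable_on_Sigma_iff, intro conjI ballI)
    fix k show "(\<lambda>d. cmod (g (k, d))) summable_on ?A"
      unfolding g_def prod.case norm_mult[of "?f k"] by (intro summable_on_cmult_right m_summable)
  next
    have "(\<lambda>k. cmod (?f k) * (\<Sum>\<^sub>\<infinity>d\<in>?A. cmod (?m d * ?f d))) summable_on ?A"
      by (intro summable_on_cmult_left dirichlet_abs_summable_on[OF s])
    moreover have "norm (\<Sum>\<^sub>\<infinity>d\<in>?A. cmod (g (k, d))) = cmod (?f k) * (\<Sum>\<^sub>\<infinity>d\<in>?A. cmod (?m d * ?f d))" for k
      unfolding g_def prod.case norm_mult[of "?f k"] infsum_cmult_right'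
      by (simp add: infsum_nonneg abs_mult)
    ultimately show "(\<lambda>k. norm (\<Sum>\<^sub>\<infinity>d\<in>?A. cmod (g (k, d)))) summable_on ?A" by simp
  qed
  then have g_summable: "g summable_on (Sigma ?A (\<lambda>_. ?A))" by (rule Infinite_Sum.abs_summable_summable)
  define T where "T = Sigma ?A (\<lambda>n. {d. d dvd n})"
  define \<phi> :: "nat \<times> nat \<Rightarrow> nat \<times> nat" where "\<phi> = (\<lambda>(k, d). (k * d, d))"
  have bij: "bij_betw \<phi> (Sigma ?A (\<lambda>_. ?A)) T"
  proof (rule bij_betw_byWitness[where f' = "\<lambda>(n, d). (n div d, d)"])
    show "(\<lambda>(n, d). (n div d, d)) ` T \<subseteq> Sigma ?A (\<lambda>_. ?A)"
      by (auto simp: T_def Suc_le_eq dvd_imp_le div_greater_zero_iff intro: Nat.gr0I)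
  qed (auto simp: \<phi>_def T_def)
  have g_eq: "g x = (case \<phi> x of (n, d) \<Rightarrow> ?m d * ?f n)" for x
    by (cases x) (simp add: g_def \<phi>_def nat_powr_mult del: of_nat_mult)
  have "(\<lambda>x. case \<phi> x of (n, d) \<Rightarrow> ?m d * ?f n) summable_on (Sigma ?A (\<lambda>_. ?A))"
    using g_summable by (subst (asm) summable_on_cong[OF g_eq])
  then have T_summable: "(\<lambda>(n, d). ?m d * ?f n) summable_on T"
    by (subst (asm) summable_on_reindex_bij_betw[OF bij])
  have "zeta s * (\<Sum>\<^sub>\<infinity>d\<in>?A. ?m d * ?f d) = (\<Sum>\<^sub>\<infinity>k\<in>?A. \<Sum>\<^sub>\<infinity>d\<in>?A. g (k, d))"
    by (simp add: zeta_def g_def infsum_cmult_right' infsum_cmult_left')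
  also have "\<dots> = infsum g (Sigma ?A (\<lambda>_. ?A))" by (rule infsum_Sigma_banach[OF g_summable])
  also have "\<dots> = (\<Sum>\<^sub>\<infinity>x\<in>Sigma ?A (\<lambda>_. ?A). case \<phi> x of (n, d) \<Rightarrow> ?m d * ?f n)"
    by (intro infsum_cong g_eq)
  also have "\<dots> = infsum (\<lambda>(n, d). ?m d * ?f n) T" by (rule infsum_reindex_bij_betw[OF bij])
  also have "\<dots> = (\<Sum>\<^sub>\<infinity>n\<in>?A. \<Sum>\<^sub>\<infinity>d | d dvd n. ?m d * ?f n)"
    using infsum_Sigma'_banach[of "\<lambda>n d. ?m d * ?f n" ?A "\<lambda>n. {d. d dvd n}"] T_summable
    by (simp add: T_def)
  also have "\<dots> = (\<Sum>\<^sub>\<infinity>n\<in>?A. if n = 1 then 1 else 0)"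
  proof (rule infsum_cong)
    fix n :: nat assume "n \<in> ?A"
    then have n: "0 < n" by auto
    then have "(\<Sum>\<^sub>\<infinity>d | d dvd n. ?m d * ?f n) = of_real (\<Sum>d | d dvd n. moebius_mu d) * ?f n"
      by (simp add: sum_distrib_right)
    then show "(\<Sum>\<^sub>\<infinity>d | d dvd n. ?m d * ?f n) = (if n = 1 then 1 else 0)"
      using sum_moebius_divisors[OF n] by simp
  qed
  also have "\<dots> = (\<Sum>\<^sub>\<infinity>n\<in>{1::nat}. 1)" by (rule infsum_cong_neutral) auto
  also have "\<dots> = 1" by simp
  finally show ?thesis .
qed

text \<open>The series has the sum \<open>1 / zeta (1 + z)\<close> for \<open>Re z > 0\<close>, which is \<open>z\<close> times the
reciprocal of the regularized zeta function at \<open>1 + z\<close>, and that reciprocal is holomorphic around the closed half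
plane.\<close>

lemma sum_moebius_div_tendsto_0: "(\<lambda>N. \<Sum>n<N. moebius_mu (Suc n) / real (Suc n)) \<longlonglongrightarrow> 0"
proof -
  define U where "U = {z. -1 < Re z} \<inter> (\<lambda>z. zeta_regularized (1 + z)) -` (- {0})"
  have hol: "(\<lambda>z. zeta_regularized (1 + z)) holomorphic_on {z. -1 < Re z}"
  proof -
    have "(\<lambda>z. 1 + z) holomorphic_on {z. -1 < Re z}"
      by (intro holomorphic_on_add holomorphic_on_const holomorphic_on_ident)
    moreover have "(\<lambda>z. 1 + z) ` {z. -1 < Re z} \<subseteq> {s. 0 < Re s}" by auto
    ultimately show ?thesis
      using holomorphic_on_compose_gen[OF _ zeta_regularized_holomorphic] by (auto simp: comp_def)
  qed
  have "open U" unfolding U_def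
    by (rule continuous_open_preimage[OF holomorphic_on_imp_continuous_on[OF hol] open_halfspace_Re_gt])
       (rule open_Compl, rule closed_singleton)
  have sums: "(\<lambda>n. complex_of_real (moebius_mu (Suc n)) * of_nat (Suc n) powr (-1 - z))
      sums (z * (1 / zeta_regularized (1 + z)))" if z: "0 < Re z" for z
  proof -
    have s: "1 < Re (1 + z)" using z by simp
    let ?t = "\<lambda>n. complex_of_real (moebius_mu n) * of_nat n powr (- (1 + z))"
    define L where "L = infsum ?t {1..}"
    have "(\<lambda>n. cmod (?t n)) summable_on {1..}"
      using bounded_dirichlet_abs_summable_on[OF s, of "\<lambda>n. of_real (moebius_mu n)"] abs_moebius_le by simp
    then have "?t summable_on {1..}" by (rule Infinite_Sum.abs_summable_summable)
    then have "(?t has_sum L) {1..}" unfolding L_def by (rule has_sum_infsum)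
    moreover have "bij_betw Suc UNIV {1..}"
      by (auto simp: bij_betw_def image_iff Suc_le_eq gr0_conv_Suc)
    ultimately have "((\<lambda>n. ?t (Suc n)) has_sum L) UNIV"
      by (subst (asm) has_sum_reindex_bij_betw[symmetric])
    then have "(\<lambda>n. ?t (Suc n)) sums L" by (rule has_sum_imp_sums)
    moreover have "L = z * (1 / zeta_regularized (1 + z))"
    proof -
      have 1: "zeta (1 + z) * L = 1" using moebius_series_mult_zeta[OF s] by (simp add: L_def)
      then have "zeta (1 + z) \<noteq> 0" by auto
      then have "L = 1 / zeta (1 + z)" using 1 by (simp add: eq_divide_eq mult.commute)
      moreover have "zeta_regularized (1 + z) = z * zeta (1 + z)" using zeta_regularized_eq_zeta[OF s] by simp
      moreover have "z \<noteq> 0" using z by auto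
      ultimately show ?thesis by simp
    qed
    ultimately show ?thesis by simp
  qed
  have "(\<lambda>N. \<Sum>n<N. complex_of_real (moebius_mu (Suc n)) / of_nat (Suc n)) \<longlonglongrightarrow> 0"
  proof (rule newman[where G = "\<lambda>z. 1 / zeta_regularized (1 + z)" and U = U and a = "\<lambda>n. of_real (moebius_mu n)"])
    show "(\<lambda>z. 1 / zeta_regularized (1 + z)) holomorphic_on U"
      by (intro holomorphic_on_divide holomorphic_on_const holomorphic_on_subset[OF hol]) (auto simp: U_def)
    show "{z. 0 \<le> Re z} \<subseteq> U" using zeta_regularized_nonzero by (auto simp: U_def)
  qed (use sums abs_moebius_le \<open>open U\<close> in auto)
  then have "(\<lambda>N. complex_of_real (\<Sum>n<N. moebius_mu (Suc n) / real (Suc n))) \<longlonglongrightarrow> of_real 0"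
    by simp
  then show ?thesis by (simp only: tendsto_of_real_iff)
qed

lemma cesaro_null:
  fixes X :: "nat \<Rightarrow> real"
  assumes "X \<longlonglongrightarrow> 0" shows "(\<lambda>N. (\<Sum>n<N. X n) / real N) \<longlonglongrightarrow> 0"
proof (rule LIMSEQ_I)
  fix r :: real assume r: "0 < r"
  obtain n0 where n0: "\<And>n. n0 \<le> n \<Longrightarrow> \<bar>X n\<bar> < r / 2"
    using LIMSEQ_D[OF assms, of "r / 2"] r by auto
  define C where "C = (\<Sum>n<n0. \<bar>X n\<bar>)"
  have "(\<lambda>N. C / real N) \<longlonglongrightarrow> 0" by (rule lim_const_over_n)
  then have "\<forall>\<^sub>F N in sequentially. C / real N < r / 2" using r by (intro order_tendstoD(2)) auto
  then have "\<forall>\<^sub>F N in sequentially. norm ((\<Sum>n<N. X n) / real N - 0) < r"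
    using eventually_gt_at_top[of 0] eventually_ge_at_top[of n0]
  proof eventually_elim
    case (elim N)
    have "\<bar>\<Sum>n<N. X n\<bar> \<le> (\<Sum>n<N. \<bar>X n\<bar>)" by (rule sum_abs)
    also have "\<dots> = C + (\<Sum>n=n0..<N. \<bar>X n\<bar>)"
      unfolding C_def using elim(3) by (simp add: lessThan_atLeast0 sum.atLeastLessThan_concat)
    also have "\<dots> \<le> C + (\<Sum>n=n0..<N. r / 2)"
      using n0 by (intro add_left_mono sum_mono) (auto intro: less_imp_le)
    also have "\<dots> \<le> C + real N * (r / 2)" using r by (simp add: mult_right_mono)
    also have "\<dots> < r * real N" using elim by (simp add: field_simps)
    finally show ?case using elim by (simp add: field_simps)
  qed
  then show "\<exists>no. \<forall>N\<ge>no. norm ((\<Sum>n<N. X n) / real N - 0) < r" by (simp add: eventually_sequentially)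
qed

text \<open>Summation by parts expresses the mean of \<open>moebius_mu\<close> as the difference of the partial sums of
\<open>moebius_mu n / n\<close> and their averages.\<close>

lemma mertens_tendsto_0: "(\<lambda>N. (\<Sum>n=1..N. moebius_mu n) / real N) \<longlonglongrightarrow> 0"
proof -
  define S where "S = (\<lambda>N. \<Sum>n<N. moebius_mu (Suc n) / real (Suc n))"
  have S: "S \<longlonglongrightarrow> 0" unfolding S_def by (rule sum_moebius_div_tendsto_0)
  have "(\<Sum>n=1..N. moebius_mu n) = real N * S N - (\<Sum>n<N. S n)" for N
  proof (induction N)
    case (Suc N)
    have "S (Suc N) = S N + moebius_mu (Suc N) / real (Suc N)" by (simp add: S_def)
    then show ?case using Suc by (simp add: field_simps)
  qed simp
  then have "(\<Sum>n=1..N. moebius_mu n) / real N = S N - (\<Sum>n<N. S n) / real N" if "0 < N" for N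
    using that by (simp add: field_simps)
  then have "\<forall>\<^sub>F N in sequentially. S N - (\<Sum>n<N. S n) / real N = (\<Sum>n=1..N. moebius_mu n) / real N"
    by (intro eventually_sequentiallyI[of 1]) simp
  moreover have "(\<lambda>N. S N - (\<Sum>n<N. S n) / real N) \<longlonglongrightarrow> 0 - 0"
    by (intro tendsto_diff S cesaro_null)
  ultimately show ?thesis using Lim_transform_eventually by force
qed

section \<open>From the Moebius function to the primes\<close>

text \<open>Both sides sum over the lattice points below the hyperbola \<open>d * k = N\<close>.\<close>

lemma sum_hyperbola_swap:
  fixes f :: "nat \<Rightarrow> nat \<Rightarrow> real"
  shows "(\<Sum>d=1..N. \<Sum>k=1..N div d. f d k) = (\<Sum>k=1..N. \<Sum>d=1..N div k. f d k)"
proof -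
  have inner: "(\<Sum>k=1..N div d. g k) = (\<Sum>k | k \<in> {1..N} \<and> d * k \<le> N. g k)" if "d \<in> {1..N}"
    for d and g :: "nat \<Rightarrow> real"
  proof (rule sum.cong)
    have "k \<le> N div d \<longleftrightarrow> d * k \<le> N" for k
      using that by (simp add: less_eq_div_iff_mult_less_eq mult.commute)
    moreover have "k \<le> N" if "d * k \<le> N" for k
      using that \<open>d \<in> {1..N}\<close> by (auto intro: order_trans[of k "d * k" N])
    ultimately show "{1..N div d} = {k \<in> {1..N}. d * k \<le> N}" by auto
  qed simp
  have "(\<Sum>d=1..N. \<Sum>k=1..N div d. f d k) = (\<Sum>d=1..N. \<Sum>k | k \<in> {1..N} \<and> d * k \<le> N. f d k)"
    by (intro sum.cong refl inner)
  also have "\<dots> = (\<Sum>k=1..N. \<Sum>d | d \<in> {1..N} \<and> d * k \<le> N. f d k)"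
    by (rule sum.swap_restrict) auto
  also have "\<dots> = (\<Sum>k=1..N. \<Sum>d=1..N div k. f d k)"
    by (rule sum.cong[OF refl]) (simp only: inner mult.commute)
  finally show ?thesis .
qed

lemma sum_divisors_sum:
  fixes g :: "nat \<Rightarrow> real"
  shows "(\<Sum>n=1..N. \<Sum>d | d dvd n. g d) = (\<Sum>d=1..N. g d * real (N div d))"
proof (induction N)
  case (Suc N)
  have "(\<Sum>d=1..Suc N. g d * real (Suc N div d))
      = (\<Sum>d=1..Suc N. g d * real (N div d) + (if d dvd Suc N then g d else 0))"
    by (intro sum.cong) (auto simp: div_Suc mod_eq_0_iff_dvd algebra_simps)
  also have "\<dots> = (\<Sum>d=1..Suc N. g d * real (N div d)) + (\<Sum>d | d dvd Suc N. g d)"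
  proof -
    have "{d. d dvd Suc N} = {d \<in> {1..Suc N}. d dvd Suc N}"
      by (auto dest: dvd_imp_le simp: Suc_le_eq intro: Nat.gr0I)
    then show ?thesis
      by (simp only: sum.distrib sum.inter_filter[OF finite_atLeastAtMost])
  qed
  also have "(\<Sum>d=1..Suc N. g d * real (N div d)) = (\<Sum>d=1..N. g d * real (N div d))" by simp
  finally show ?case using Suc by simp
qed simp

lemma sum_moebius_floor:
  assumes "1 \<le> N" shows "(\<Sum>d=1..N. moebius_mu d * real (N div d)) = 1"
proof -
  have "(\<Sum>d=1..N. moebius_mu d * real (N div d)) = (\<Sum>n=1..N. if n = 1 then 1 else 0)"
    unfolding sum_divisors_sum[symmetric] by (intro sum.cong sum_moebius_divisors) auto
  then show ?thesis using assms by simp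
qed

text \<open>Summatory form of Moebius inversion: \<open>F\<close> is the summatory function of the Dirichlet convolution of \<open>g\<close> with 1.\<close>

lemma moebius_inversion_sum:
  fixes g F :: "nat \<Rightarrow> real"
  assumes F: "\<And>M. F M = (\<Sum>e=1..M. g e * real (M div e))"
  shows "(\<Sum>d=1..N. moebius_mu d * F (N div d)) = (\<Sum>e=1..N. g e)"
proof -
  have "(\<Sum>d=1..N. moebius_mu d * F (N div d))
      = (\<Sum>d=1..N. \<Sum>e=1..N div d. g e * (moebius_mu d * real (N div d div e)))"
    by (simp add: F sum_distrib_left mult_ac)
  also have "\<dots> = (\<Sum>e=1..N. \<Sum>d=1..N div e. g e * (moebius_mu d * real (N div d div e)))"
    by (rule sum_hyperbola_swap)
  also have "\<dots> = (\<Sum>e=1..N. g e * (\<Sum>d=1..N div e. moebius_mu d * real (N div e div d)))"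
    by (simp add: sum_distrib_left div_mult2_eq[symmetric] mult.commute[of _ "_ :: nat"])
  also have "\<dots> = (\<Sum>e=1..N. g e)"
    by (intro sum.cong refl) (subst sum_moebius_floor, auto simp: Suc_le_eq div_greater_zero_iff)
  finally show ?thesis .
qed

definition psi :: "nat \<Rightarrow> real" where
  "psi N = (\<Sum>n=1..N. mangoldt n)"

definition divisor_sum :: "nat \<Rightarrow> real" where
  "divisor_sum N = (\<Sum>d=1..N. real (N div d))"

definition log_sum :: "nat \<Rightarrow> real" where
  "log_sum N = (\<Sum>n=1..N. ln (real n))"

lemma log_sum_eq: "log_sum N = (\<Sum>d=1..N. mangoldt d * real (N div d))"
  unfolding log_sum_def sum_divisors_sum[symmetric]
  by (intro sum.cong refl) (auto simp: mangoldt_sum)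

text \<open>The summatory function of \<open>ln n - d n + 2 * euler_mascheroni\<close>, with \<open>d n\<close> the number of divisors.
Moebius inversion turns the summand into \<open>mangoldt n - 1\<close>, except at \<open>n = 1\<close>; the constant is the one that makes it of order
\<open>sqrt N\<close>.\<close>

definition comparison_sum :: "nat \<Rightarrow> real" where
  "comparison_sum N = log_sum N - divisor_sum N + 2 * euler_mascheroni * real N"

lemma psi_minus_eq:
  assumes "1 \<le> N"
  shows "psi N - real N + 2 * euler_mascheroni = (\<Sum>d=1..N. moebius_mu d * comparison_sum (N div d))"
proof -
  have "(\<Sum>d=1..N. moebius_mu d * comparison_sum (N div d))
      = (\<Sum>d=1..N. moebius_mu d * log_sum (N div d)) - (\<Sum>d=1..N. moebius_mu d * divisor_sum (N div d))
        + 2 * euler_mascheroni * (\<Sum>d=1..N. moebius_mu d * real (N div d))"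
    by (simp add: comparison_sum_def algebra_simps sum.distrib sum_subtractf sum_distrib_left)
  also have "(\<Sum>d=1..N. moebius_mu d * log_sum (N div d)) = psi N"
    unfolding psi_def by (rule moebius_inversion_sum[OF log_sum_eq])
  also have "(\<Sum>d=1..N. moebius_mu d * divisor_sum (N div d)) = (\<Sum>e=1..N. 1)"
    by (rule moebius_inversion_sum) (simp add: divisor_sum_def)
  finally show ?thesis using sum_moebius_floor[OF assms] by simp
qed

lemma ln_Suc_diff:
  assumes "1 \<le> n"
  shows "1 / (real n + 1) \<le> ln (real n + 1) - ln (real n)" "ln (real n + 1) - ln (real n) \<le> 1 / real n"
proof -
  have n: "0 < real n" using assms by simp
  have "ln (real n / (real n + 1)) \<le> real n / (real n + 1) - 1"
    using n by (intro ln_le_minus_one) simp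
  then show "1 / (real n + 1) \<le> ln (real n + 1) - ln (real n)"
    using n by (simp add: ln_div field_simps)
  have "ln ((real n + 1) / real n) \<le> (real n + 1) / real n - 1"
    using n by (intro ln_le_minus_one) simp
  then show "ln (real n + 1) - ln (real n) \<le> 1 / real n"
    using n by (simp add: ln_div field_simps)
qed

lemma log_sum_bounds:
  assumes "1 \<le> N"
  shows "real N * ln (real N) - real N + 1 \<le> log_sum N"
    and "log_sum N \<le> real N * ln (real N) - real N + 1 + ln (real N)"
proof -
  have "real N * ln (real N) - real N + 1 \<le> log_sum N \<and>
      log_sum N \<le> real N * ln (real N) - real N + 1 + ln (real N)"
    using assms
  proof (induction N rule: dec_induct)
    case base
    then show ?case by (simp add: log_sum_def)
  next
    case (step n)
    have n: "0 < real n" using step by simp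
    let ?D = "ln (real n + 1) - ln (real n)"
    have "log_sum (Suc n) = log_sum n + ln (real n + 1)" by (simp add: log_sum_def add.commute)
    moreover have "real n * ?D \<le> 1" "1 \<le> (real n + 1) * ?D"
      using ln_Suc_diff[of n] step(1) n by (simp_all add: field_simps)
    ultimately show ?case using step.IH by (simp add: algebra_simps)
  qed
  then show "real N * ln (real N) - real N + 1 \<le> log_sum N"
    "log_sum N \<le> real N * ln (real N) - real N + 1 + ln (real N)" by auto
qed

text \<open>Dirichlet's hyperbola method: the lattice points with \<open>d > q\<close> have \<open>k \<le> q\<close>, so they are
counted by the columns \<open>k \<le> q\<close> minus the square \<open>d \<le> q\<close>, \<open>k \<le> q\<close>.\<close>

lemma divisor_sum_hyperbola:
  assumes q: "q * q \<le> N" "N < (q + 1) * (q + 1)"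
  shows "divisor_sum N = 2 * (\<Sum>d=1..q. real (N div d)) - real q * real q"
proof -
  have "q \<le> N" using q(1) by (cases q) auto
  have small: "N div b \<le> q" if "q < b" for b
  proof -
    have "N < (q + 1) * b" using q(2) that mult_le_mono2[of "q + 1" b "q + 1"] by linarith
    then show ?thesis using that by (simp add: div_less_iff_less_mult less_Suc_eq_le[symmetric])
  qed
  have large: "q \<le> N div b" if "1 \<le> b" "b \<le> q" for b
  proof -
    have "q * b \<le> N" using q(1) that mult_le_mono2[of b q q] by linarith
    then show ?thesis using that by (simp add: less_eq_div_iff_mult_less_eq)
  qed
  have split: "(\<Sum>d=1..N. f d) = (\<Sum>d=1..q. f d) + (\<Sum>d=q+1..N. f d)" for f :: "nat \<Rightarrow> real"
    using sum.ub_add_nat[of 1 q f "N - q"] \<open>q \<le> N\<close> by simp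
  have "(\<Sum>d=q+1..N. real (N div d)) = (\<Sum>d=1..N. \<Sum>k=1..N div d. if q < d then 1 else 0)"
    by (subst split) (simp add: small)
  also have "\<dots> = (\<Sum>k=1..N. \<Sum>d=1..N div k. if q < d then 1 else 0)"
    by (rule sum_hyperbola_swap)
  also have "\<dots> = (\<Sum>k=1..N. real (card {q<..N div k}))"
  proof (intro sum.cong refl)
    fix k
    have "{1..N div k} \<inter> {d. q < d} = {q<..N div k}" by auto
    then show "(\<Sum>d=1..N div k. if q < d then 1 else 0) = real (card {q<..N div k})"
      by (simp add: sum.If_cases)
  qed
  also have "\<dots> = (\<Sum>k=1..q. real (card {q<..N div k}))"
    by (subst split) (simp add: small)
  also have "\<dots> = (\<Sum>k=1..q. real (N div k) - real q)"
    by (intro sum.cong refl) (simp add: large of_nat_diff)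
  also have "\<dots> = (\<Sum>k=1..q. real (N div k)) - real q * real q" by (simp add: sum_subtractf)
  finally show ?thesis
    using split[of "\<lambda>d. real (N div d)"] unfolding divisor_sum_def by linarith
qed

lemma harm_approx:
  assumes "1 \<le> q" shows "\<bar>harm q - ln (real q) - euler_mascheroni\<bar> \<le> 1 / real q"
proof -
  obtain m where m: "q = Suc m" using assms by (cases q) auto
  have q: "0 < real q" using assms by simp
  have "euler_mascheroni \<le> harm q - ln (real q + 1) + 1 / (2 * real q)"
    using euler_mascheroni_upper[of m] by (simp add: m algebra_simps)
  moreover have "harm q - ln (real q + 1) \<le> (euler_mascheroni :: real)"
    using euler_mascheroni_lower[of m] by (simp add: m algebra_simps) (smt (verit) zero_le_divide_1_iff of_nat_0_le_iff)
  moreover have "ln (real q) \<le> ln (real q + 1)" using q by simp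
  moreover have "ln (real q + 1) - ln (real q) \<le> 1 / real q" using ln_Suc_diff(2)[OF assms] .
  moreover have "1 / (2 * real q) \<le> 1 / real q" using q by (simp add: field_simps)
  ultimately show ?thesis by linarith
qed

text \<open>With \<open>q\<close> the integer part of \<open>sqrt N\<close>, replace \<open>N div d\<close> by \<open>N / d\<close> and the
harmonic sum by \<open>ln q + euler_mascheroni\<close>. Each of these costs a multiple of \<open>q\<close>.\<close>

lemma divisor_sum_approx:
  assumes "1 \<le> N"
  shows "\<bar>divisor_sum N - (real N * ln (real N) + (2 * euler_mascheroni - 1) * real N)\<bar> \<le> 20 * sqrt (real N)"
proof -
  define q where "q = floor_sqrt N"
  have q: "q * q \<le> N" "N < (q + 1) * (q + 1)"
    using floor_sqrt_power2_le[of N] Suc_floor_sqrt_power2_gt[of N] by (simp_all add: q_def power2_eq_square)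
  have q1: "1 \<le> q" using assms by (simp add: q_def Suc_le_eq)
  define x n where "x = real q" "n = real N"
  have x: "1 \<le> x" using q1 by (simp add: x_n_def)
  have "real (q * q) \<le> real N" "real N \<le> real (q * q + 2 * q)"
    using q unfolding of_nat_le_iff by simp_all
  then have xn: "x * x \<le> n" and n2: "n \<le> x * x + 2 * x" by (simp_all add: x_n_def)
  define T where "T = (\<Sum>d=1..q. real (N div d))"
  have T: "\<bar>T - n * harm q\<bar> \<le> x"
  proof -
    have "\<bar>real (N div d) - n * inverse (real d)\<bar> \<le> 1" if "d \<in> {1..q}" for d
    proof -
      have d: "0 < real d" using that by simp
      have "N div d * d \<le> N" "N \<le> (N div d + 1) * d"
        using that div_mult_mod_eq[of N d] mod_less_divisor[of d N]
        by (simp_all add: Suc_le_eq less_imp_le dividend_less_times_div add.commute mult.commute)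
      then have "real (N div d) * real d \<le> n" "n \<le> (real (N div d) + 1) * real d"
        unfolding x_n_def by (metis of_nat_le_iff of_nat_mult, metis of_nat_le_iff of_nat_mult of_nat_add of_nat_1)
      then have "real (N div d) \<le> n * inverse (real d)" "n * inverse (real d) \<le> real (N div d) + 1"
        using d by (simp_all add: field_simps)
      then show ?thesis by linarith
    qed
    then have "\<bar>\<Sum>d=1..q. real (N div d) - n * inverse (real d)\<bar> \<le> (\<Sum>d=1..q. 1)"
      by (intro order_trans[OF sum_abs] sum_mono)
    then show ?thesis by (simp add: T_def harm_def sum_subtractf sum_distrib_left x_n_def)
  qed
  have H: "\<bar>n * harm q - n * (ln x + euler_mascheroni)\<bar> \<le> n * (1 / x)"
  proof -
    have "\<bar>n * (harm q - ln x - euler_mascheroni)\<bar> \<le> n * (1 / x)"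
      unfolding abs_mult using harm_approx[OF q1] by (intro mult_mono) (auto simp: x_n_def)
    then show ?thesis by (simp add: algebra_simps)
  qed
  have n0: "0 < n" using x xn by (smt (verit) mult_pos_pos)
  have nx: "n * (1 / x) \<le> 3 * x"
  proof -
    have "x \<le> x * x" using mult_right_mono[of 1 x x] x by simp
    then have "n \<le> (3 * x) * x" using n2 by linarith
    then show ?thesis using x by (simp add: field_simps)
  qed
  have ln1: "2 * ln x \<le> ln n"
  proof -
    have "ln (x * x) \<le> ln n" using x xn n0 by (subst ln_le_cancel_iff) auto
    then show ?thesis using x by (simp add: ln_mult)
  qed
  have ln2: "n * ln n - 2 * (n * ln x) \<le> 6 * x"
  proof -
    have "ln (n / (x * x)) \<le> n / (x * x) - 1" using x n0 by (intro ln_le_minus_one) simp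
    also have "n / (x * x) \<le> (x * x + 2 * x) / (x * x)" using n2 x by (intro divide_right_mono) auto
    also have "(x * x + 2 * x) / (x * x) - 1 = 2 / x" using x by (simp add: field_simps)
    finally have "ln n - 2 * ln x \<le> 2 / x" using x n0 by (simp add: ln_div ln_mult)
    have "n * ln n - 2 * (n * ln x) = n * (ln n - 2 * ln x)" by (simp add: algebra_simps)
    also have "\<dots> \<le> n * (2 / x)"
      using \<open>ln n - 2 * ln x \<le> 2 / x\<close> n0 by (intro mult_left_mono) auto
    also have "\<dots> = 2 * (n * (1 / x))" by simp
    also have "\<dots> \<le> 2 * (3 * x)" by (intro mult_left_mono nx) simp
    finally show ?thesis by simp
  qed
  have ln3: "0 \<le> n * ln n - 2 * (n * ln x)"
    using mult_left_mono[OF ln1, of n] n0 by (simp add: algebra_simps)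
  have D: "divisor_sum N = 2 * T - x * x"
    using divisor_sum_hyperbola[OF q] by (simp add: T_def x_n_def)
  have "\<bar>divisor_sum N - (n * ln n + (2 * euler_mascheroni - 1) * n)\<bar> \<le> 20 * x"
  proof -
    define u v where "u = n * ln x" "v = n * (euler_mascheroni :: real)"
    have "n * (ln x + euler_mascheroni) = u + v" "(2 * euler_mascheroni - 1) * n = 2 * v - n"
      by (simp_all add: u_v_def algebra_simps)
    then show ?thesis
      using T H nx ln2 ln3 D xn n2 x unfolding u_v_def[symmetric] by linarith
  qed
  also have "20 * x \<le> 20 * sqrt n"
    using x xn real_le_rsqrt[of x n] by (simp add: power2_eq_square)
  finally show ?thesis by (simp add: x_n_def)
qed

lemma comparison_sum_bound:
  assumes "1 \<le> N" shows "\<bar>comparison_sum N\<bar> \<le> 22 * sqrt (real N)"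
proof -
  have s: "1 \<le> sqrt (real N)" using assms by simp
  have "ln (real N) = 2 * ln (sqrt (real N))" using assms by (simp add: ln_sqrt)
  moreover have "ln (sqrt (real N)) \<le> sqrt (real N) - 1" using s by (intro ln_le_minus_one) linarith
  ultimately have "1 + ln (real N) \<le> 2 * sqrt (real N)" by linarith
  moreover have "0 \<le> ln (real N)" using assms by simp
  moreover have "(2 * euler_mascheroni - 1) * real N = 2 * euler_mascheroni * real N - real N"
    by (simp add: algebra_simps)
  ultimately show ?thesis
    using log_sum_bounds[OF assms] divisor_sum_approx[OF assms] unfolding comparison_sum_def
    by linarith
qed

definition mertens :: "nat \<Rightarrow> real" where
  "mertens N = (\<Sum>n=1..N. moebius_mu n)"

lemma mertens_div_tendsto_0:
  assumes "1 \<le> v" shows "(\<lambda>N. mertens (N div v) / real N) \<longlonglongrightarrow> 0"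
proof -
  have "filterlim (\<lambda>N. N div v) at_top sequentially"
    unfolding filterlim_at_top
  proof
    fix Z
    have "Z \<le> N div v" if "Z * v \<le> N" for N
      using that assms by (simp add: less_eq_div_iff_mult_less_eq)
    then show "\<forall>\<^sub>F N in sequentially. Z \<le> N div v" by (rule eventually_sequentiallyI)
  qed
  moreover have "(\<lambda>m. \<bar>mertens m / real m\<bar>) \<longlonglongrightarrow> 0"
    using mertens_tendsto_0 by (simp only: mertens_def tendsto_rabs_zero_iff)
  ultimately have lim: "(\<lambda>N. \<bar>mertens (N div v) / real (N div v)\<bar>) \<longlonglongrightarrow> 0"
    by (rule filterlim_compose[rotated])
  have "\<bar>mertens (N div v) / real N\<bar> \<le> \<bar>mertens (N div v) / real (N div v)\<bar>" for N
  proof (cases "N div v = 0")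
    case True
    then show ?thesis by (simp add: mertens_def)
  next
    case False
    then have "0 < real (N div v)" by simp
    moreover have "real (N div v) \<le> real N" by simp
    ultimately show ?thesis unfolding abs_divide by (intro frac_le) auto
  qed
  then show ?thesis by (intro Lim_null_comparison[OF _ lim] always_eventually) simp
qed

text \<open>The quotient \<open>N div d\<close> takes the value \<open>v\<close> exactly for \<open>N div Suc v < d \<le> N div v\<close>.\<close>

lemma sum_over_large_divisors:
  fixes R :: "nat \<Rightarrow> real"
  shows "(\<Sum>d\<in>{N div Suc K<..N}. moebius_mu d * R (N div d))
    = (\<Sum>v=1..K. R v * (mertens (N div v) - mertens (N div Suc v)))"
proof (induction K)
  case (Suc K)
  let ?a = "N div Suc (Suc K)" and ?b = "N div Suc K"
  have ab: "?a \<le> ?b" "?b \<le> N" by (auto intro: div_le_mono2)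
  have "{?a<..N} = {?a<..?b} \<union> {?b<..N}" "{?a<..?b} \<inter> {?b<..N} = {}"
    using ivl_disj_un_two(6)[OF ab] by auto
  then have "(\<Sum>d\<in>{?a<..N}. moebius_mu d * R (N div d))
      = (\<Sum>d\<in>{?a<..?b}. moebius_mu d * R (N div d)) + (\<Sum>d\<in>{?b<..N}. moebius_mu d * R (N div d))"
    by (simp add: sum.union_disjoint)
  also have "(\<Sum>d\<in>{?a<..?b}. moebius_mu d * R (N div d)) = (\<Sum>d\<in>{?a<..?b}. moebius_mu d * R (Suc K))"
  proof (rule sum.cong[OF refl])
    fix d assume d: "d \<in> {?a<..?b}"
    then have "0 < d" by auto
    have "Suc K \<le> N div d"
      using d \<open>0 < d\<close> by (simp add: less_eq_div_iff_mult_less_eq mult.commute)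
    moreover have "N div d < Suc (Suc K)"
      using d \<open>0 < d\<close> by (simp add: div_less_iff_less_mult mult.commute)
    ultimately have "N div d = Suc K" by simp
    then show "moebius_mu d * R (N div d) = moebius_mu d * R (Suc K)" by simp
  qed
  also have "\<dots> = R (Suc K) * (mertens ?b - mertens ?a)"
  proof -
    have "{1..?b} = {1..?a} \<union> {?a<..?b}" "{1..?a} \<inter> {?a<..?b} = {}"
      using ab(1) by auto
    then have "mertens ?b = mertens ?a + (\<Sum>d\<in>{?a<..?b}. moebius_mu d)"
      by (simp add: mertens_def sum.union_disjoint)
    then show ?thesis by (simp add: sum_distrib_left mult.commute)
  qed
  finally show ?case using Suc by simp
qed simp

lemma sum_inverse_sqrt_le: "(\<Sum>d=1..D. 1 / sqrt (real d)) \<le> 2 * sqrt (real D)"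
proof (induction D)
  case (Suc D)
  define x y where "x = sqrt (real D)" "y = sqrt (real (Suc D))"
  have xy: "0 \<le> x" "x \<le> y" "0 < y" "y * y = x * x + 1" by (simp_all add: x_y_def)
  have "1 = (y - x) * (y + x)" using xy(4) by (simp add: algebra_simps)
  also have "\<dots> \<le> (y - x) * (2 * y)" using xy by (intro mult_left_mono) auto
  finally have "1 / y \<le> 2 * (y - x)" using xy(3) by (simp add: field_simps)
  then show ?case using Suc by (simp add: x_y_def)
qed simp

text \<open>Axer's argument. In the formula for \<open>psi N - N\<close> the divisors \<open>d \<le> N / (K + 1)\<close> contribute
\<open>O (N / sqrt K)\<close> by the square-root bound on \<open>comparison_sum\<close>. For the larger \<open>d\<close> only
the quotients \<open>1, \<dots>, K\<close> occur, and each contributes \<open>o (N)\<close> because \<open>moebius_mu\<close> has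
mean value 0.\<close>

theorem psi_asymptotic: "(\<lambda>N. psi N / real N) \<longlonglongrightarrow> 1"
proof -
  define Q where "Q = (\<lambda>N. \<Sum>d=1..N. moebius_mu d * comparison_sum (N div d))"
  have "(\<lambda>N. Q N / real N) \<longlonglongrightarrow> 0"
  proof (rule LIMSEQ_I)
    fix r :: real assume r: "0 < r"
    \<comment> \<open>Makes the contribution \<open>44 / sqrt (K + 1)\<close> of the small divisors less than \<open>r / 2\<close>.\<close>
    define K where "K = nat \<lceil>(88 / r)\<^sup>2\<rceil>"
    define s where "s = sqrt (real (Suc K))"
    have s0: "0 < s" by (simp add: s_def)
    have "(88 / r)\<^sup>2 < real (Suc K)" unfolding K_def by linarith
    then have "88 / r < s" unfolding s_def by (rule real_less_rsqrt)
    then have K: "44 / s < r / 2" using r s0 by (simp add: field_simps)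
    define P where "P = (\<lambda>N. \<Sum>v=1..K. comparison_sum v *
      (mertens (N div v) / real N - mertens (N div Suc v) / real N))"
    have "P \<longlonglongrightarrow> (\<Sum>v=1..K. comparison_sum v * (0 - 0))"
      unfolding P_def by (intro tendsto_sum tendsto_mult tendsto_const tendsto_diff mertens_div_tendsto_0) auto
    then have "P \<longlonglongrightarrow> 0" by simp
    then have "\<forall>\<^sub>F N in sequentially. \<bar>P N\<bar> < r / 2"
      using tendsto_rabs_zero[of P] r by (intro order_tendstoD(2)) auto
    then have "\<forall>\<^sub>F N in sequentially. norm (Q N / real N - 0) < r"
      using eventually_gt_at_top[of 0]
    proof eventually_elim
      case (elim N)
      let ?f = "\<lambda>d. moebius_mu d * comparison_sum (N div d)"
      define D where "D = N div Suc K"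
      have N: "0 < real N" using elim by simp
      have "D \<le> N" by (simp add: D_def)
      then have "{1..N} = {1..D} \<union> {D<..N}" "{1..D} \<inter> {D<..N} = {}" by auto
      then have Q: "Q N = (\<Sum>d=1..D. ?f d) + (\<Sum>d\<in>{D<..N}. ?f d)"
        by (simp add: Q_def sum.union_disjoint)
      have large: "(\<Sum>d\<in>{D<..N}. ?f d) = real N * P N"
        unfolding D_def sum_over_large_divisors P_def sum_distrib_left
        using N by (intro sum.cong refl) (simp add: field_simps)
      have small: "\<bar>\<Sum>d=1..D. ?f d\<bar> \<le> real N * (44 / s)"
      proof -
        have "\<bar>?f d\<bar> \<le> 22 * sqrt (real N) * (1 / sqrt (real d))" if d: "d \<in> {1..D}" for d
        proof -
          have d0: "0 < d" "d \<le> N" using d \<open>D \<le> N\<close> by auto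
          then have "1 \<le> N div d" by (simp add: Suc_le_eq div_greater_zero_iff)
          have "real (N div d) * real d \<le> real N"
            by (metis div_times_less_eq_dividend of_nat_le_iff of_nat_mult)
          then have "real (N div d) \<le> real N / real d" using d0 by (simp add: field_simps)
          have "\<bar>?f d\<bar> \<le> 1 * \<bar>comparison_sum (N div d)\<bar>"
            unfolding abs_mult by (intro mult_right_mono abs_moebius_le) simp
          also have "\<dots> \<le> 22 * sqrt (real (N div d))"
            using comparison_sum_bound[OF \<open>1 \<le> N div d\<close>] by simp
          also have "\<dots> \<le> 22 * sqrt (real N / real d)"
            using \<open>real (N div d) \<le> real N / real d\<close> by simp
          finally show ?thesis by (simp add: real_sqrt_divide)
        qed
        then have "\<bar>\<Sum>d=1..D. ?f d\<bar> \<le> (\<Sum>d=1..D. 22 * sqrt (real N) * (1 / sqrt (real d)))"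
          by (intro order_trans[OF sum_abs] sum_mono)
        also have "\<dots> = 22 * sqrt (real N) * (\<Sum>d=1..D. 1 / sqrt (real d))"
          by (simp only: sum_distrib_left)
        also have "\<dots> \<le> 22 * sqrt (real N) * (2 * sqrt (real D))"
          by (intro mult_left_mono sum_inverse_sqrt_le) auto
        also have "sqrt (real D) \<le> sqrt (real N) / s"
        proof -
          have "real D * real (Suc K) \<le> real N"
            unfolding D_def by (metis div_times_less_eq_dividend of_nat_le_iff of_nat_mult)
          then have "real D \<le> real N / real (Suc K)" by (simp add: pos_le_divide_eq del: of_nat_Suc)
          then show ?thesis unfolding s_def by (simp add: real_sqrt_divide[symmetric] del: of_nat_Suc)
        qed
        finally have "\<bar>\<Sum>d=1..D. ?f d\<bar> \<le> 22 * sqrt (real N) * (2 * (sqrt (real N) / s))"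
          by (simp add: mult_left_mono)
        also have "\<dots> = (sqrt (real N) * sqrt (real N)) * (44 / s)" by simp
        finally show ?thesis by (simp only: real_sqrt_mult_self abs_of_nat)
      qed
      have "\<bar>Q N\<bar> \<le> \<bar>\<Sum>d=1..D. ?f d\<bar> + \<bar>real N * P N\<bar>"
        unfolding Q large by (rule abs_triangle_ineq)
      also have "\<dots> \<le> real N * (44 / s) + real N * \<bar>P N\<bar>"
        using small by (simp add: abs_mult)
      also have "\<dots> < real N * (r / 2) + real N * (r / 2)"
        using N K elim by (intro add_strict_mono mult_strict_left_mono) auto
      finally show ?case using N by (simp add: field_simps)
    qed
    then show "\<exists>no. \<forall>N\<ge>no. norm (Q N / real N - 0) < r" by (simp add: eventually_sequentially)
  qed
  moreover have "(\<lambda>N. 2 * euler_mascheroni / real N) \<longlonglongrightarrow> 0" by (rule lim_const_over_n)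
  ultimately have "(\<lambda>N. Q N / real N - 2 * euler_mascheroni / real N + 1) \<longlonglongrightarrow> 0 - 0 + 1"
    by (intro tendsto_intros)
  moreover have "\<forall>\<^sub>F N in sequentially. Q N / real N - 2 * euler_mascheroni / real N + 1 = psi N / real N"
  proof (rule eventually_sequentiallyI[of 1])
    fix N :: nat assume "1 \<le> N"
    from psi_minus_eq[OF this] have "Q N = psi N - real N + 2 * euler_mascheroni" by (simp add: Q_def)
    then show "Q N / real N - 2 * euler_mascheroni / real N + 1 = psi N / real N"
      using \<open>1 \<le> N\<close> by (simp add: field_simps)
  qed
  ultimately show ?thesis using Lim_transform_eventually by fastforce
qed

section \<open>Sums of a weight over the primes\<close>

text \<open>The scaled contribution of a prime \<open>p = u * n\<close> to the packing bound: \<open>u - u\<^sup>2\<close> for the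
difference \<open>p\<close>, and half of the increase to \<open>2 * u - 4 * u\<^sup>2\<close> for the difference \<open>2 * p\<close>,
when it is one (for \<open>u \<le> 1 / 3\<close>).\<close>

definition gain :: "real \<Rightarrow> real" where
  "gain u = u - u\<^sup>2 + max 0 (u - 3 * u\<^sup>2) / 2"

lemma gain_nonneg: "0 \<le> u \<Longrightarrow> u \<le> 1 \<Longrightarrow> 0 \<le> gain u"
  using mult_left_mono[of u 1 u] by (simp add: gain_def power2_eq_square)

lemma gain_le_1: "0 \<le> u \<Longrightarrow> u \<le> 1 \<Longrightarrow> gain u \<le> 1"
proof -
  assume "0 \<le> u" "u \<le> 1"
  have "0 \<le> (u - 1 / 2)\<^sup>2" "0 \<le> (u - 1 / 6)\<^sup>2" by simp_all
  then have "u - u\<^sup>2 \<le> 1 / 4" "u - 3 * u\<^sup>2 \<le> 1 / 2"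
    by (simp_all add: power2_eq_square algebra_simps)
  then have "u - u\<^sup>2 \<le> 1 / 4" "max 0 (u - 3 * u\<^sup>2) \<le> 1 / 2" by (simp_all only: max.bounded_iff) simp
  then have "gain u \<le> 1 / 4 + (1 / 2) / 2"
    unfolding gain_def by (intro add_mono divide_right_mono) simp_all
  then show ?thesis by simp
qed

lemma gain_lipschitz:
  assumes "0 \<le> u" "u \<le> 1" "0 \<le> v" "v \<le> 1"
  shows "\<bar>gain u - gain v\<bar> \<le> 4 * \<bar>u - v\<bar>"
proof -
  have "\<bar>max 0 a - max 0 b\<bar> \<le> \<bar>a - b\<bar>" for a b :: real by (auto simp: max_def)
  then have m: "\<bar>max 0 (u - 3 * u\<^sup>2) - max 0 (v - 3 * v\<^sup>2)\<bar> \<le> \<bar>(u - 3 * u\<^sup>2) - (v - 3 * v\<^sup>2)\<bar>" .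
  have "(u - 3 * u\<^sup>2) - (v - 3 * v\<^sup>2) = (u - v) * (1 - 3 * (u + v))"
    "(u - u\<^sup>2) - (v - v\<^sup>2) = (u - v) * (1 - (u + v))"
    by (simp_all add: power2_eq_square algebra_simps)
  moreover have "\<bar>(u - v) * (1 - 3 * (u + v))\<bar> \<le> \<bar>u - v\<bar> * 5" "\<bar>(u - v) * (1 - (u + v))\<bar> \<le> \<bar>u - v\<bar> * 1"
    unfolding abs_mult using assms by (intro mult_left_mono; simp)+
  ultimately have "\<bar>(u - u\<^sup>2) - (v - v\<^sup>2)\<bar> \<le> \<bar>u - v\<bar> * 1"
    "\<bar>max 0 (u - 3 * u\<^sup>2) - max 0 (v - 3 * v\<^sup>2)\<bar> \<le> \<bar>u - v\<bar> * 5"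
    using m by simp_all
  moreover define a b where "a = max 0 (u - 3 * u\<^sup>2)" "b = max 0 (v - 3 * v\<^sup>2)"
  ultimately show ?thesis unfolding gain_def a_b_def[symmetric] by linarith
qed

text \<open>A Riemann sum for the integral \<open>1 / 6 + 1 / 108 = 19 / 108\<close> of \<open>gain\<close> over the unit interval.\<close>

lemma sum_gain_ge:
  assumes "3 \<le> n"
  shows "19 / 108 * real n - 2 \<le> (\<Sum>m=1..n. gain (real m / real n))"
proof -
  define x where "x = real n"
  have x: "3 \<le> x" using assms by (simp add: x_def)
  define K where "K = n div 3"
  define y where "y = real K"
  have K: "3 * K \<le> n" "n \<le> 3 * K + 2" unfolding K_def by linarith+
  then have "real (3 * K) \<le> real n" "real n \<le> real (3 * K + 2)" by (simp_all only: of_nat_le_iff)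
  then have y: "3 * y \<le> x" "x \<le> 3 * y + 2" by (simp_all add: x_def y_def)
  have "K \<le> n" using K by simp
  \<comment> \<open>Closed forms for both parts of the weight; the second part is nonnegative for \<open>m \<le> n div 3\<close>.\<close>
  have s1: "(\<Sum>m=1..k. real m) = real k * (real k + 1) / 2" for k
    by (induction k) (auto simp: field_simps)
  have s2: "(\<Sum>m=1..k. (real m)\<^sup>2) = real k * (real k + 1) * (2 * real k + 1) / 6" for k
    by (induction k) (auto simp: field_simps power2_eq_square)
  have A: "(\<Sum>m=1..n. real m / x - (real m / x)\<^sup>2) = x / 6 - 1 / (6 * x)"
  proof -
    have "(\<Sum>m=1..n. real m / x - (real m / x)\<^sup>2) = (\<Sum>m=1..n. real m) / x - (\<Sum>m=1..n. (real m)\<^sup>2) / x\<^sup>2"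
      by (simp add: sum_subtractf sum_divide_distrib power_divide)
    also have "\<dots> = x / 6 - 1 / (6 * x)"
      unfolding s1 s2 x_def[symmetric] using x by (simp add: field_simps power2_eq_square)
    finally show ?thesis .
  qed
  have B: "(\<Sum>m=1..K. real m / x - 3 * (real m / x)\<^sup>2) = y * (y + 1) * (x - 2 * y - 1) / (2 * x\<^sup>2)"
  proof -
    have "(\<Sum>m=1..K. real m / x - 3 * (real m / x)\<^sup>2) = (\<Sum>m=1..K. real m) / x - 3 * (\<Sum>m=1..K. (real m)\<^sup>2) / x\<^sup>2"
      by (simp add: sum_subtractf sum_divide_distrib power_divide sum_distrib_left)
    also have "\<dots> = y * (y + 1) * (x - 2 * y - 1) / (2 * x\<^sup>2)"
      unfolding s1 s2 y_def[symmetric] using x by (simp add: field_simps power2_eq_square)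
    finally show ?thesis .
  qed
  have "(x - 2) * (x - 3) * (x + 1) / 27 \<le> y * (y + 1) * (x - 2 * y - 1)"
  proof -
    have "(x - 2) / 3 * ((x + 1) / 3) \<le> y * (y + 1)" using x y by (intro mult_mono) auto
    then have "(x - 2) / 3 * ((x + 1) / 3) * ((x - 3) / 3) \<le> y * (y + 1) * (x - 2 * y - 1)"
      using x y by (intro mult_mono) auto
    then show ?thesis by (simp add: algebra_simps)
  qed
  moreover have "x ^ 3 - 4 * x\<^sup>2 \<le> (x - 2) * (x - 3) * (x + 1)"
    using x by (simp add: power2_eq_square power3_eq_cube algebra_simps)
  ultimately have "(x ^ 3 - 4 * x\<^sup>2) / 27 / (2 * x\<^sup>2) \<le> y * (y + 1) * (x - 2 * y - 1) / (2 * x\<^sup>2)"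
    by (intro divide_right_mono) auto
  moreover have "(x ^ 3 - 4 * x\<^sup>2) / 27 / (2 * x\<^sup>2) = (x - 4) / 54"
    using x by (simp add: power2_eq_square power3_eq_cube field_simps)
  ultimately have B': "(x - 4) / 54 \<le> (\<Sum>m=1..K. real m / x - 3 * (real m / x)\<^sup>2)"
    unfolding B by (simp only:)
  have "(\<Sum>m=1..K. real m / x - 3 * (real m / x)\<^sup>2) \<le> (\<Sum>m=1..K. max 0 (real m / x - 3 * (real m / x)\<^sup>2))"
    by (intro sum_mono) simp
  also have "\<dots> \<le> (\<Sum>m=1..n. max 0 (real m / x - 3 * (real m / x)\<^sup>2))"
    using \<open>K \<le> n\<close> by (intro sum_mono2) auto
  finally have "(x - 4) / 54 \<le> (\<Sum>m=1..n. max 0 (real m / x - 3 * (real m / x)\<^sup>2))" using B' by linarith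
  moreover have "(\<Sum>m=1..n. gain (real m / x)) = (\<Sum>m=1..n. real m / x - (real m / x)\<^sup>2)
      + (\<Sum>m=1..n. max 0 (real m / x - 3 * (real m / x)\<^sup>2)) / 2"
    by (simp add: gain_def sum.distrib sum_divide_distrib)
  moreover have "1 / (6 * x) \<le> 1" using x by simp
  moreover have "19 / 108 * x - 2 \<le> t"
    if "(x - 4) / 54 \<le> s" "t = x / 6 - r + s / 2" "r \<le> 1" for r s t :: real
    using that by (simp add: field_simps)
  ultimately show ?thesis unfolding A x_def[symmetric] by blast
qed

lemma sum_by_parts:
  fixes E g :: "nat \<Rightarrow> real"
  assumes "E 0 = 0"
  shows "(\<Sum>m=1..n. (E m - E (m - 1)) * g m) = E n * g n - (\<Sum>m<n. E m * (g (Suc m) - g m))"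
  using assms by (induction n) (auto simp: algebra_simps)

text \<open>Summation by parts moves the weight onto \<open>psi m - m\<close>, which is \<open>o (m)\<close>, against
increments of \<open>g\<close> of order \<open>1 / n\<close>.\<close>

lemma weighted_psi_tendsto:
  fixes g :: "real \<Rightarrow> real"
  assumes lip: "\<And>u v. 0 \<le> u \<Longrightarrow> u \<le> 1 \<Longrightarrow> 0 \<le> v \<Longrightarrow> v \<le> 1 \<Longrightarrow> \<bar>g u - g v\<bar> \<le> C * \<bar>u - v\<bar>"
    and g1: "g 1 = 0"
  shows "(\<lambda>n. ((\<Sum>m=1..n. mangoldt m * g (real m / real n)) - (\<Sum>m=1..n. g (real m / real n))) / real n)
    \<longlonglongrightarrow> 0"
proof -
  define E where "E = (\<lambda>n. psi n - real n)"
  have E0: "E 0 = 0" by (simp add: E_def psi_def)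
  have "(\<lambda>n. psi n / real n - 1) \<longlonglongrightarrow> 1 - 1" by (intro tendsto_diff psi_asymptotic tendsto_const)
  then have "(\<lambda>n. psi n / real n - 1) \<longlonglongrightarrow> 0" by simp
  moreover have "\<forall>\<^sub>F n in sequentially. psi n / real n - 1 = E n / real n"
    by (rule eventually_sequentiallyI[of 1]) (simp add: E_def field_simps)
  ultimately have "(\<lambda>n. E n / real n) \<longlonglongrightarrow> 0" by (rule Lim_transform_eventually)
  then have "(\<lambda>n. \<bar>E n / real n\<bar>) \<longlonglongrightarrow> 0" by (rule tendsto_rabs_zero)
  from tendsto_mult_right_zero[OF cesaro_null[OF this], of C]
  have lim: "(\<lambda>n. C * ((\<Sum>m<n. \<bar>E m / real m\<bar>) / real n)) \<longlonglongrightarrow> 0" .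
  have "norm (((\<Sum>m=1..n. mangoldt m * g (real m / real n)) - (\<Sum>m=1..n. g (real m / real n))) / real n)
      \<le> C * ((\<Sum>m<n. \<bar>E m / real m\<bar>) / real n)" if "1 \<le> n" for n
  proof -
    have n: "0 < real n" using that by simp
    define w where "w = (\<lambda>m. g (real m / real n))"
    have C0: "0 \<le> C" using lip[of 0 1] by simp
    have dE: "E m - E (m - 1) = mangoldt m - 1" if "m \<in> {1..n}" for m
      using that by (cases m) (auto simp: E_def psi_def)
    have "(\<Sum>m=1..n. mangoldt m * w m) - (\<Sum>m=1..n. w m) = (\<Sum>m=1..n. (mangoldt m - 1) * w m)"
      by (simp add: sum_subtractf left_diff_distrib)
    also have "\<dots> = (\<Sum>m=1..n. (E m - E (m - 1)) * w m)"
      by (rule sum.cong[OF refl]) (simp only: dE)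
    also have "\<dots> = - (\<Sum>m<n. E m * (w (Suc m) - w m))"
      using sum_by_parts[of E w n] E0 g1 n by (simp add: w_def)
    finally have "\<bar>(\<Sum>m=1..n. mangoldt m * w m) - (\<Sum>m=1..n. w m)\<bar> \<le> (\<Sum>m<n. \<bar>E m * (w (Suc m) - w m)\<bar>)"
      using sum_abs[of "\<lambda>m. E m * (w (Suc m) - w m)" "{..<n}"] by simp
    also have "\<dots> \<le> (\<Sum>m<n. C * \<bar>E m / real m\<bar>)"
    proof (rule sum_mono)
      fix m assume "m \<in> {..<n}"
      then have m: "m < n" by simp
      show "\<bar>E m * (w (Suc m) - w m)\<bar> \<le> C * \<bar>E m / real m\<bar>"
      proof (cases "m = 0")
        case True
        then show ?thesis by (simp add: E0)
      next
        case False
        have "\<bar>w (Suc m) - w m\<bar> \<le> C * \<bar>real (Suc m) / real n - real m / real n\<bar>"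
          unfolding w_def using m n by (intro lip) auto
        also have "\<dots> = C * (1 / real n)" using n by (simp add: diff_divide_distrib[symmetric])
        also have "\<dots> \<le> C * (1 / real m)" using m False C0 by (intro mult_left_mono divide_left_mono) auto
        finally have "\<bar>E m\<bar> * \<bar>w (Suc m) - w m\<bar> \<le> \<bar>E m\<bar> * (C * (1 / real m))"
          by (rule mult_left_mono) simp
        then show ?thesis by (simp add: abs_mult mult.commute)
      qed
    qed
    also have "\<dots> = C * (\<Sum>m<n. \<bar>E m / real m\<bar>)" by (simp only: sum_distrib_left)
    finally have "\<bar>(\<Sum>m=1..n. mangoldt m * w m) - (\<Sum>m=1..n. w m)\<bar> / real n
        \<le> C * (\<Sum>m<n. \<bar>E m / real m\<bar>) / real n"
      using n by (intro divide_right_mono) auto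
    then show ?thesis by (simp add: w_def)
  qed
  then show ?thesis
    by (intro Lim_null_comparison[OF eventually_sequentiallyI[of 1] lim])
qed

section \<open>The packing bound\<close>

text \<open>A proper prime power \<open>p ^ k \<le> n\<close> has \<open>p \<le> sqrt n\<close> and \<open>k \<le> log 2 n\<close>.\<close>

lemma card_proper_primepows_le:
  "card {m \<in> {1..n}. primepow m \<and> \<not> prime m} \<le> floor_sqrt n * floor_log n"
proof -
  have "{m \<in> {1..n}. primepow m \<and> \<not> prime m}
      \<subseteq> (\<lambda>(p, k). p ^ k) ` ({1..floor_sqrt n} \<times> {1..floor_log n})"
  proof
    fix m assume m: "m \<in> {m \<in> {1..n}. primepow m \<and> \<not> prime m}"
    then obtain p k where pk: "prime p" "0 < k" "m = p ^ k" by (auto simp: primepow_def)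
    have "k \<noteq> 1" using m pk by auto
    then have "2 \<le> k" using pk(2) by simp
    have p: "2 \<le> p" using pk(1) by (rule prime_ge_2_nat)
    have "p\<^sup>2 \<le> p ^ k" using p \<open>2 \<le> k\<close> by (intro power_increasing) auto
    then have "p\<^sup>2 \<le> n" using m pk(3) by simp
    then have 1: "p \<le> floor_sqrt n" by (simp add: le_floor_sqrt_iff)
    have "2 ^ k \<le> p ^ k" using p by (intro power_mono) auto
    then have "2 ^ k \<le> n" using m pk(3) by simp
    then have 2: "k \<le> floor_log n" using floor_log_le_iff[of "2 ^ k" n] by simp
    show "m \<in> (\<lambda>(p, k). p ^ k) ` ({1..floor_sqrt n} \<times> {1..floor_log n})"
      using 1 2 p pk by (intro image_eqI[of _ _ "(p, k)"]) auto
  qed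
  then have "card {m \<in> {1..n}. primepow m \<and> \<not> prime m} \<le> card ({1..floor_sqrt n} \<times> {1..floor_log n})"
    by (rule surj_card_le[rotated]) simp
  then show ?thesis by simp
qed

lemma sum_mangoldt_le_sum_primes:
  fixes g :: "nat \<Rightarrow> real"
  assumes "1 \<le> n" and g: "\<And>m. m \<in> {1..n} \<Longrightarrow> 0 \<le> g m \<and> g m \<le> 1"
  shows "(\<Sum>m=1..n. mangoldt m * g m)
    \<le> (\<Sum>p | prime p \<and> p \<le> n. ln (real p) * g p) + sqrt (real n) * log 2 (real n) * ln (real n)"
proof -
  let ?f = "\<lambda>m. mangoldt m * g m"
  let ?T = "{m \<in> {1..n}. primepow m \<and> \<not> prime m}"
  have P: "{p. prime p \<and> p \<le> n} \<subseteq> {1..n}" using prime_ge_1_nat by auto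
  have "(\<Sum>m=1..n. ?f m) = (\<Sum>m\<in>{p. prime p \<and> p \<le> n} \<union> ?T. ?f m)"
  proof (rule sum.mono_neutral_right)
    show "{p. prime p \<and> p \<le> n} \<union> ?T \<subseteq> {1..n}" using P by auto
    show "\<forall>i\<in>{1..n} - ({p. prime p \<and> p \<le> n} \<union> ?T). ?f i = 0"
      by (auto simp: mangoldt_def)
  qed simp
  also have "\<dots> = (\<Sum>m | prime m \<and> m \<le> n. ?f m) + (\<Sum>m\<in>?T. ?f m)"
    by (rule sum.union_disjoint) (auto intro: finite_subset[OF P])
  also have "(\<Sum>m | prime m \<and> m \<le> n. ?f m) = (\<Sum>p | prime p \<and> p \<le> n. ln (real p) * g p)"
    by (rule sum.cong) auto
  also have "(\<Sum>m\<in>?T. ?f m) \<le> (\<Sum>m\<in>?T. ln (real n))"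
  proof (rule sum_mono)
    fix m assume m: "m \<in> ?T"
    have "mangoldt m \<le> ln (real m)" using m by (intro mangoldt_le) auto
    also have "\<dots> \<le> ln (real n)" using m by auto
    finally have "mangoldt m \<le> ln (real n)" .
    then have "?f m \<le> ln (real n) * 1" using m g[of m] mangoldt_nonneg[of m] \<open>1 \<le> n\<close>
      by (intro mult_mono) auto
    then show "?f m \<le> ln (real n)" by simp
  qed
  also have "\<dots> = real (card ?T) * ln (real n)" by simp
  also have "\<dots> \<le> (sqrt (real n) * log 2 (real n)) * ln (real n)"
  proof (rule mult_right_mono)
    have "real (card ?T) \<le> real (floor_sqrt n) * real (floor_log n)"
      using card_proper_primepows_le[of n] by (metis of_nat_le_iff of_nat_mult)
    also have "\<dots> \<le> sqrt (real n) * log 2 (real n)"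
    proof (rule mult_mono)
      have "real ((floor_sqrt n)\<^sup>2) \<le> real n" by (simp only: of_nat_le_iff floor_sqrt_power2_le)
      then show "real (floor_sqrt n) \<le> sqrt (real n)" by (intro real_le_rsqrt) simp
      have "real (2 ^ floor_log n) \<le> real n"
        using floor_log_exp2_le[of n] \<open>1 \<le> n\<close> by (simp only: of_nat_le_iff)
      then show "real (floor_log n) \<le> log 2 (real n)"
        using \<open>1 \<le> n\<close> by (simp add: le_log_iff powr_realpow)
    qed (use \<open>1 \<le> n\<close> in auto)
    finally show "real (card ?T) \<le> sqrt (real n) * log 2 (real n)" .
  qed (use \<open>1 \<le> n\<close> in simp)
  finally show ?thesis by simp
qed

text \<open>The loss \<open>3 / 2 * n\<^sup>2\<close> comes from the factor \<open>n - 1\<close> in place of \<open>n\<close> in the length of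
a hull.\<close>

lemma packed_into_ge_sum_gain:
  assumes "packed_into {1..n} (prog n) N" and n: "3 \<le> n"
  shows "(real n)\<^sup>2 * (\<Sum>p | prime p \<and> 3 \<le> p \<and> p < n. gain (real p / real n)) - 3 / 2 * (real n)\<^sup>2 \<le> real N"
proof -
  define f where "f = (\<lambda>d. (int n - 1) * int d - (int d)\<^sup>2)"
  define P where "P = {p. prime p \<and> 3 \<le> p \<and> p < n}"
  have "P \<subseteq> {..<n}" by (auto simp: P_def)
  then have P: "finite P" "card P \<le> n"
    using finite_subset card_mono[of "{..<n}" P] by auto
  have "2 * (real n)\<^sup>2 * gain (real p / real n) - 3 * real n
      \<le> real_of_int (2 * f p + (if 3 * p \<le> n then f (2 * p) - f p else 0))" if p: "p \<in> P" for p
  proof -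
    define x y where "x = real n" "y = real p"
    have xy: "0 < x" "0 < y" "y \<le> x" using p by (auto simp: x_y_def P_def)
    have f: "real_of_int (f d) = (x - 1) * real d - (real d)\<^sup>2" for d
      by (simp add: f_def x_y_def)
    have m: "y / x - 3 * (y / x)\<^sup>2 = (y * (x - 3 * y)) / x\<^sup>2"
      using xy by (simp add: field_simps power2_eq_square)
    show ?thesis
    proof (cases "3 * p \<le> n")
      case True
      then have "real (3 * p) \<le> real n" by (simp only: of_nat_le_iff)
      then have "3 * y \<le> x" by (simp add: x_y_def)
      then have "0 \<le> y / x - 3 * (y / x)\<^sup>2" unfolding m using xy by simp
      then have "gain (y / x) = y / x - (y / x)\<^sup>2 + (y / x - 3 * (y / x)\<^sup>2) / 2"
        by (simp add: gain_def)
      moreover have "2 * x\<^sup>2 * (y / x - (y / x)\<^sup>2 + (y / x - 3 * (y / x)\<^sup>2) / 2) = 2 * (x * y - y\<^sup>2) + (x * y - 3 * y\<^sup>2)"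
        using xy by (simp add: field_simps power2_eq_square)
      ultimately have "2 * x\<^sup>2 * gain (y / x) = 2 * (x * y - y\<^sup>2) + (x * y - 3 * y\<^sup>2)" by simp
      then show ?thesis
        using True xy unfolding x_y_def[symmetric]
        by (simp add: f x_y_def(2)[symmetric] power2_eq_square algebra_simps)
    next
      case False
      then have "real n \<le> real (3 * p)" by (simp only: of_nat_le_iff)
      then have "x \<le> 3 * y" by (simp add: x_y_def)
      then have "y / x - 3 * (y / x)\<^sup>2 \<le> 0" unfolding m using xy
        by (intro divide_nonpos_nonneg mult_nonneg_nonpos) auto
      then have "gain (y / x) = y / x - (y / x)\<^sup>2" by (simp add: gain_def)
      moreover have "2 * x\<^sup>2 * (y / x - (y / x)\<^sup>2) = 2 * (x * y - y\<^sup>2)"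
        using xy by (simp add: field_simps power2_eq_square)
      ultimately have "2 * x\<^sup>2 * gain (y / x) = 2 * (x * y - y\<^sup>2)" by simp
      then show ?thesis
        using False xy unfolding x_y_def[symmetric]
        by (simp add: f x_y_def(2)[symmetric] power2_eq_square algebra_simps)
    qed
  qed
  then have "(\<Sum>p\<in>P. 2 * (real n)\<^sup>2 * gain (real p / real n) - 3 * real n)
      \<le> (\<Sum>p\<in>P. real_of_int (2 * f p + (if 3 * p \<le> n then f (2 * p) - f p else 0)))"
    by (rule sum_mono)
  also have "\<dots> = real_of_int (\<Sum>p\<in>P. 2 * f p + (if 3 * p \<le> n then f (2 * p) - f p else 0))" by simp
  also have "\<dots> \<le> real_of_int (2 * int N)"
    using sum_primes_le_of_packed[OF assms] unfolding P_def f_def of_int_le_iff .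
  finally have "2 * (real n)\<^sup>2 * (\<Sum>p\<in>P. gain (real p / real n)) - real (card P) * (3 * real n) \<le> 2 * real N"
    by (simp add: sum_subtractf sum_distrib_left)
  moreover have "real (card P) * (3 * real n) \<le> 3 * (real n)\<^sup>2"
    using P(2) mult_right_mono[of "real (card P)" "real n" "3 * real n"] by (simp add: power2_eq_square)
  ultimately show ?thesis unfolding P_def[symmetric] by simp
qed

lemma min_pack_packed: "packed_into {1..n} (prog n) (min_pack n)"
  using LeastI_ex[OF ex_packed_into_prog[of n, unfolded Bex_def]] unfolding min_pack_def by blast

text \<open>Since \<open>ln p \<le> ln n\<close>, the sum of \<open>gain (p / n)\<close> over the primes is at least \<open>1 / ln n\<close>
times the sum weighted by \<open>ln p\<close>, which by the prime number theorem is \<open>19 / 108 * n\<close> up to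
\<open>o (n)\<close>. The sequence \<open>\<epsilon>\<close> collects all errors after division by \<open>n ^ 3 / ln n\<close>.\<close>

theorem corollary1p6:
  shows "\<exists>\<epsilon> :: nat \<Rightarrow> real. \<epsilon> \<in> o(\<lambda>_. 1) \<and>
    (\<forall>\<^sub>F n in sequentially.
       real (min_pack n) \<ge> (19 / 108 - \<epsilon> n) * (real n ^ 3 / ln (real n)))"
proof -
  define W where "W = (\<lambda>n. \<Sum>m=1..n. mangoldt m * gain (real m / real n))"
  define S where "S = (\<lambda>n. \<Sum>m=1..n. gain (real m / real n))"
  define H where "H = (\<lambda>n. \<Sum>p | prime p \<and> 3 \<le> p \<and> p < n. gain (real p / real n))"
  define err where "err = (\<lambda>n. sqrt (real n) * log 2 (real n) * ln (real n))"
  define \<epsilon> where "\<epsilon> = (\<lambda>n. 2 / real n - (W n - S n) / real n + err n / real n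
    + 5 / 2 * (ln (real n) / real n))"
  have "(\<lambda>n. (W n - S n) / real n) \<longlonglongrightarrow> 0"
    unfolding W_def S_def by (rule weighted_psi_tendsto[OF gain_lipschitz]) (auto simp: gain_def)
  moreover have "(\<lambda>n. err n / real n) \<longlonglongrightarrow> 0" unfolding err_def by real_asymp
  moreover have "(\<lambda>n. ln (real n) / real n) \<longlonglongrightarrow> 0" by real_asymp
  ultimately have "\<epsilon> \<longlonglongrightarrow> 0 - 0 + 0 + 5 / 2 * 0"
    unfolding \<epsilon>_def by (intro tendsto_intros lim_const_over_n)
  then have "\<epsilon> \<in> o(\<lambda>_. 1)" by (intro smalloI_tendsto) auto
  moreover have "\<forall>\<^sub>F n in sequentially.
      real (min_pack n) \<ge> (19 / 108 - \<epsilon> n) * (real n ^ 3 / ln (real n))"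
  proof (rule eventually_sequentiallyI[of 3])
    fix n :: nat assume n: "3 \<le> n"
    define x L where "x = real n" "L = ln (real n)"
    have x: "3 \<le> x" using n by (simp add: x_L_def)
    have L: "0 < L" using n by (simp add: x_L_def)
    have gain: "0 \<le> gain (real m / real n) \<and> gain (real m / real n) \<le> 1" if "m \<in> {1..n}" for m
      using that by (intro conjI gain_nonneg gain_le_1) (auto simp: divide_simps)
    have "W n \<le> (\<Sum>p | prime p \<and> p \<le> n. ln (real p) * gain (real p / real n)) + err n"
      unfolding W_def err_def by (rule sum_mangoldt_le_sum_primes) (use n gain in auto)
    also have "(\<Sum>p | prime p \<and> p \<le> n. ln (real p) * gain (real p / real n))
        \<le> (\<Sum>p | prime p \<and> p \<le> n. L * gain (real p / real n))"
    proof (rule sum_mono)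
      fix p assume "p \<in> {p. prime p \<and> p \<le> n}"
      then have "1 \<le> p" "p \<le> n" using prime_ge_1_nat by auto
      then show "ln (real p) * gain (real p / real n) \<le> L * gain (real p / real n)"
        using gain[of p] by (intro mult_right_mono) (auto simp: x_L_def)
    qed
    also have "\<dots> = L * (\<Sum>p | prime p \<and> p \<le> n. gain (real p / real n))" by (simp only: sum_distrib_left)
    also have "(\<Sum>p | prime p \<and> p \<le> n. gain (real p / real n)) \<le> H n + 1"
    proof -
      let ?A = "{p. prime p \<and> 3 \<le> p \<and> p < n}"
      have fin: "finite ?A" by (rule finite_subset[of _ "{..n}"]) auto
      \<comment> \<open>The prime 2, and \<open>n\<close> if it is prime, are absent from \<open>H\<close>; the weight vanishes at 1.\<close>
      have "p = 2 \<or> p = n \<or> p \<in> ?A" if "prime p" "p \<le> n" for p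
        using that prime_ge_2_nat[OF that(1)] by (cases "p = 2") auto
      then have "{p. prime p \<and> p \<le> n} \<subseteq> insert 2 (insert n ?A)" by blast
      then have "(\<Sum>p | prime p \<and> p \<le> n. gain (real p / real n))
          \<le> (\<Sum>p\<in>insert 2 (insert n ?A). gain (real p / real n))"
      proof (rule sum_mono2[rotated])
        fix b assume "b \<in> insert 2 (insert n ?A) - {p. prime p \<and> p \<le> n}"
        then have "b \<in> {1..n}" using n by auto
        then show "0 \<le> gain (real b / real n)" using gain by blast
      qed (use fin in auto)
      also have "\<dots> = gain (real 2 / real n) + (gain (real n / real n) + H n)"
        using fin n by (simp add: H_def)
      also have "gain (real n / real n) = 0" using n by (simp add: gain_def)
      also have "gain (real 2 / real n) \<le> 1" using gain[of 2] n by auto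
      finally show ?thesis by simp
    qed
    finally have W: "W n \<le> L * (H n + 1) + err n" using L by (simp add: mult_left_mono)
    have S: "19 / 108 * x - 2 \<le> S n" using sum_gain_ge[OF n] by (simp add: S_def x_L_def)
    have "x * (19 / 108 - \<epsilon> n) = 19 / 108 * x - 2 + (W n - S n) - err n - 5 / 2 * L"
      using n by (simp add: \<epsilon>_def x_L_def field_simps)
    also have "\<dots> \<le> L * (H n - 3 / 2)" using W S by (simp add: algebra_simps)
    finally have "x\<^sup>2 * (x * (19 / 108 - \<epsilon> n)) \<le> x\<^sup>2 * (L * (H n - 3 / 2))"
      by (rule mult_left_mono) simp
    also have "\<dots> = L * (x\<^sup>2 * H n - 3 / 2 * x\<^sup>2)" by (simp add: algebra_simps)
    also have "\<dots> \<le> L * real (min_pack n)"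
      using packed_into_ge_sum_gain[OF min_pack_packed n] L
      by (intro mult_left_mono) (auto simp: H_def x_L_def)
    finally have "(19 / 108 - \<epsilon> n) * x ^ 3 \<le> L * real (min_pack n)"
      by (simp add: power2_eq_square power3_eq_cube mult_ac)
    then have "(19 / 108 - \<epsilon> n) * (x ^ 3 / L) \<le> real (min_pack n)"
      using L by (simp add: pos_divide_le_eq mult.commute)
    then show "(19 / 108 - \<epsilon> n) * (real n ^ 3 / ln (real n)) \<le> real (min_pack n)"
      by (simp only: x_L_def)
  qed
  ultimately show ?thesis by blast
qed

end
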